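(* Let $S$ be a Polish space, $B>0$, and let $Z_{1:n}=((X_1,Y_1),\dots,(X_n,Y_n))$ be a sequence of independent (not necessarily identically distributed) random elements of $S\times\mathbb{R}$. Let $\mathcal{G}$ be a family of Borel measurable functions $S\to\mathbb{R}$ for which there exist $$\hat g\in\arg\min_{g\in\mathcal{G}}\sum_{k=1}^n|g(X_k)-T_BY_k|^2,\qquad\tilde g\in\arg\min_{g\in\mathcal{G}}\sum_{k=1}^n\mathrm{E}\big[|g(X_k)-T_BY_k|^2\big],$$ let $\hat\phi_B=T_B\hat g$, and let $Z'_{1:n}$ be an independent copy of $Z_{1:n}$. Then for every $(c,\lambda,\delta)\in(1,\infty)\times(1,\infty)\times(0,1)$, the inequality $$\mathrm{E}\left[\sum_{k=1}^n\big(h_{\hat\phi_B,k}(Z'_k)-h_{\tilde g,k}(Z'_k)\big)\,\Big|\,Z_{1:n}\right]\le\sum_{k=1}^n\big(\lambda h_{\tilde g,k}(Z_k)-\mathrm{E}[h_{\tilde g,k}(Z_k)]\big)+\max\left\{n\,\epsilon_n(c,\lambda),\ \frac1{b(c,\lambda)}\Big(\log a(c,\lambda,\epsilon_n(c,\lambda))+\log(1/\delta)\Big)\right\}$$ holds with probability at least $1-\delta$, where $h_{g,k}$, $a$, $b$, $\epsilon_n$ are the functions defined in the context.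
   Context: $T_By=\min\{\max\{y,-B\},B\}$ is the truncation operator, and $T_B\mathcal{G}=\{T_Bg:g\in\mathcal{G}\}$, where $(T_Bg)(x)=T_B(g(x))$. For $1\le k\le n$, $\phi_{B,k}:S\to[-B,B]$ is a Borel function with $\phi_{B,k}(X_k)=\mathrm{E}[T_BY_k\mid X_k]$ almost surely. For a Borel function $g:S\to\mathbb{R}$ and $1\le k\le n$, $$h_{g,k}(x,y)=|g(x)-T_By|^2-|\phi_{B,k}(x)-T_By|^2,\qquad(x,y)\in S\times\mathbb{R}.$$ The function $\hat g$ depends on the sample $Z_{1:n}$; $\mathrm{E}[h_{\hat\phi_B,k}(Z'_k)\mid Z_{1:n}]$ is the integral over the law of $Z'_k$ with $\hat\phi_B$ held fixed. Covering numbers: for $x_{1:n}\in S^n$, a family $\mathcal{F}$ of Borel functions $S\to\mathbb{R}$ and $r\ge0$, $\mathcal{N}_1(\mathcal{F},x_{1:n},r)$ is the smallest $m\in\mathbb{N}$ such that there is a set $\mathcal{L}_0$ of $m$ elements $l_{1:n}=(l_1,\dots,l_n)$, with each $l_k:S\to\mathbb{R}$ Borel, such that for every $f\in\mathcal{F}$ there is $l_{1:n}\in\mathcal{L}_0$ with $\frac1n\sum_{k=1}^n|l_k(x_k)-f(x_k)|\le r$ (and $\infty$ if there is none). For $c,\lambda>1$ and $\epsilon>0$ define $$A(x_{1:n},c,\lambda,\epsilon)=2(c+1)(2c+3)\,\mathcal{N}_1\left(T_B\mathcal{G},x_{1:n},\frac1{2^5}\frac1B\frac1{\lambda(c-1)+1}\Big(1-\frac1c\Big)\epsilon\right),\qquad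 a(c,\lambda,\epsilon)=\mathrm{E}[A(X_{1:n},c,\lambda,\epsilon)],$$ $$\epsilon_n(c,\lambda)=8B^2\left(-(\lambda-1)+\sqrt{(\lambda-1)^2+c(c+1)\lambda^2/n}\right),$$ $$b(c,\lambda)=\frac1{2^5B^2}\,\frac1{\left(\frac13(1-\frac1c)(1-\frac1\lambda)+(2\lambda-1)\right)^2}\Big(1-\frac1c\Big)^3\Big(1-\frac1\lambda\Big).$$ Standing assumption: families of functions are nonempty and pointwise measurable, i.e. there is a countable subfamily of $\mathcal{G}$ such that every element of $\mathcal{G}$ is the pointwise limit of a sequence from that subfamily. *)

theory Defs
  imports "HOL-Probability.Probability"
begin

definition trunc :: "real \<Rightarrow> real \<Rightarrow> real" where
  "trunc B y = min (max y (- B)) B"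

definition trunc_family :: "real \<Rightarrow> ('a \<Rightarrow> real) set \<Rightarrow> ('a \<Rightarrow> real) set" where
  "trunc_family B G = (\<lambda>g x. trunc B (g x)) ` G"

definition pointwise_measurable :: "('a \<Rightarrow> real) set \<Rightarrow> bool" where
  "pointwise_measurable G \<longleftrightarrow>
     (\<exists>G0. countable G0 \<and> G0 \<subseteq> G \<and>
        (\<forall>g\<in>G. \<exists>s. (\<forall>i::nat. s i \<in> G0) \<and> (\<forall>x. (\<lambda>i. s i x) \<longlonglongrightarrow> g x)))"

text \<open>The parameter \<open>\<phi>\<close> is the regression function \<open>\<phi>\<^bsub>B,k\<^esub>\<close>.\<close>

definition excess :: "real \<Rightarrow> ('a \<Rightarrow> real) \<Rightarrow> ('a \<Rightarrow> real) \<Rightarrow> 'a \<times> real \<Rightarrow> real" where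
  "excess B \<phi> g = (\<lambda>(x, y). \<bar>g x - trunc B y\<bar>\<^sup>2 - \<bar>\<phi> x - trunc B y\<bar>\<^sup>2)"

text \<open>The infimum of the empty set is \<open>\<infinity>\<close> in \<^typ>\<open>enat\<close>. The tuples are extensional, so that
  \<^term>\<open>card L0\<close> counts n-tuples of functions.\<close>

definition covering_number ::
    "nat \<Rightarrow> ('a::topological_space \<Rightarrow> real) set \<Rightarrow> (nat \<Rightarrow> 'a) \<Rightarrow> real \<Rightarrow> enat" where
  "covering_number n F x r =
     Inf {enat (card L0) | L0.
       finite L0 \<and> L0 \<subseteq> (\<Pi>\<^sub>E k\<in>{1..n}. borel_measurable borel) \<and>
       (\<forall>f\<in>F. \<exists>l\<in>L0. (1 / real n) * (\<Sum>k=1..n. \<bar>l k (x k) - f (x k)\<bar>) \<le> r)}"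

definition A_cov :: "nat \<Rightarrow> real \<Rightarrow> ('a::topological_space \<Rightarrow> real) set \<Rightarrow> (nat \<Rightarrow> 'a)
    \<Rightarrow> real \<Rightarrow> real \<Rightarrow> real \<Rightarrow> ennreal" where
  "A_cov n B G x c lam \<epsilon> =
     ennreal (2 * (c + 1) * (2 * c + 3)) *
     ennreal_of_enat (covering_number n (trunc_family B G) x
       (1 / 2 ^ 5 * (1 / B) * (1 / (lam * (c - 1) + 1)) * (1 - 1 / c) * \<epsilon>))"

definition a_cov :: "'w measure \<Rightarrow> (nat \<Rightarrow> 'w \<Rightarrow> 'a::topological_space) \<Rightarrow> nat \<Rightarrow> real
    \<Rightarrow> ('a \<Rightarrow> real) set \<Rightarrow> real \<Rightarrow> real \<Rightarrow> real \<Rightarrow> ennreal" where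
  "a_cov M X n B G c lam \<epsilon> = (\<integral>\<^sup>+ \<omega>. A_cov n B G (\<lambda>k. X k \<omega>) c lam \<epsilon> \<partial>M)"

definition eps_n :: "nat \<Rightarrow> real \<Rightarrow> real \<Rightarrow> real \<Rightarrow> real" where
  "eps_n n B c lam =
     8 * B\<^sup>2 * (- (lam - 1) + sqrt ((lam - 1)\<^sup>2 + c * (c + 1) * lam\<^sup>2 / real n))"

definition b_rate :: "real \<Rightarrow> real \<Rightarrow> real \<Rightarrow> real" where
  "b_rate B c lam =
     1 / (2 ^ 5 * B\<^sup>2) *
     (1 / (1 / 3 * (1 - 1 / c) * (1 - 1 / lam) + (2 * lam - 1))\<^sup>2) *
     (1 - 1 / c) ^ 3 * (1 - 1 / lam)"

text \<open>The Bochner integral of a non-integrable function is 0. The elements of the function family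
  need not be square integrable, so the expectation is taken with values in the extended reals:
  \<open>E f\<^sup>+ - E f\<^sup>-\<close>, where \<^const>\<open>ennreal\<close> maps negative reals to 0. It is meant for
  functions bounded on one side, for which at most one of the two terms is infinite.\<close>

definition ext_expectation :: "'w measure \<Rightarrow> ('w \<Rightarrow> real) \<Rightarrow> ereal" where
  "ext_expectation M f =
     enn2ereal (\<integral>\<^sup>+ \<omega>. ennreal (f \<omega>) \<partial>M) - enn2ereal (\<integral>\<^sup>+ \<omega>. ennreal (- f \<omega>) \<partial>M)"

lemma ext_expectation_integrable:
  assumes "integrable M f"
  shows "ext_expectation M f = ereal (integral\<^sup>L M f)"
proof -
  have "(\<integral>\<^sup>+ \<omega>. ennreal (f \<omega>) \<partial>M) < \<infinity>" "(\<integral>\<^sup>+ \<omega>. ennreal (- f \<omega>) \<partial>M) < \<infinity>"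
    using assms by (auto simp: real_integrable_def less_top)
  then obtain p q where "0 \<le> p" "0 \<le> q"
    "(\<integral>\<^sup>+ \<omega>. ennreal (f \<omega>) \<partial>M) = ennreal p" "(\<integral>\<^sup>+ \<omega>. ennreal (- f \<omega>) \<partial>M) = ennreal q"
    by (metis ennreal_cases infinity_ennreal_def less_irrefl)
  then show ?thesis
    by (simp add: ext_expectation_def real_lebesgue_integral_def[OF assms])
qed

definition ext_ln :: "ennreal \<Rightarrow> ereal" where
  "ext_ln a = (if a = 0 then - \<infinity> else if a = \<infinity> then \<infinity> else ereal (ln (enn2real a)))"

end

theory Submission
  imports Defs
begin

text \<open>
  Write \<open>\<phi>\<^sub>k\<close> for the regression functions, \<open>y = T\<^sub>B Y\<close>, and \<open>h\<^sub>f = (f - y)\<^sup>2 - (\<phi>\<^sub>k - y)\<^sup>2\<close> for the excess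
  loss of a function \<open>f\<close> with values in \<open>[-B, B]\<close>. Truncation does not increase the empirical loss,
  because the responses \<open>y\<close> lie in \<open>[-B, B]\<close>; so the truncated empirical minimizer has an empirical
  excess of at most that of \<open>gtilde\<close>, and the claim follows from a one-sided uniform deviation
  inequality: with probability at least \<open>1 - \<delta>\<close>, every truncated member \<open>f\<close> of the family satisfies
  \<open>\<Sum> E h\<^sub>f \<le> \<lambda> \<Sum> h\<^sub>f(Z\<^sub>k) + n \<epsilon>\<close>. Only this inequality is probabilistic (lemmas
  \<open>uniform_deviation\<close> and \<open>rate_bound\<close>).

  With \<open>d = f - \<phi>\<^sub>k\<close> one has \<open>h\<^sub>f = d\<^sup>2 + 2 d (\<phi>\<^sub>k - y)\<close>: a nonnegative function of the covariate plus
  noise that is centred given the covariate. In particular \<open>E h\<^sub>f = E d\<^sup>2\<close>. This split drives the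
  proof, which works with a factor \<open>\<alpha>\<close> strictly between \<open>1\<close> and \<open>\<lambda>\<close>.

  Ghost sample. For a function \<open>f\<close> that violates the inequality, an independent sample satisfies
  \<open>\<alpha> \<Sum> d\<^sup>2(X'\<^sub>k) \<ge> \<Sum> E d\<^sup>2 - n \<epsilon> / 8\<close> with probability at least \<open>1/9\<close>
  (\<open>ghost_lower_tail\<close>, a Cantelli bound). This is where \<open>\<epsilon> \<ge> \<epsilon>\<^sub>n\<close> enters. Hence
  (\<open>ghost_symmetrization\<close>) it remains to bound the probability that
  \<open>\<alpha> \<Sum> d\<^sup>2(X'\<^sub>k) - \<lambda> \<Sum> h\<^sub>f(Z\<^sub>k)\<close> is large for some \<open>f\<close>.

  Swapping. Exchanging \<open>Z\<^sub>k\<close> with \<open>Z'\<^sub>k\<close> for the indices in a set \<open>J\<close> preserves the joint law. After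
  the exchange the difference is the sum of two one-sample statistics of the form
  \<open>\<alpha> \<Sum>\<^sub>J d\<^sup>2 - \<lambda> \<Sum>\<^sub>I\<^sub>-\<^sub>J h\<^sub>f\<close>, one for each sample, and one of them must be at least half as large
  (\<open>swap_bound\<close>). Averaging over all \<open>J\<close> plays the role of random signs.

  Exponential moments. For constants \<open>v\<^sub>k\<close> in place of \<open>f\<close>, the average over \<open>J\<close> of the exponential
  moment factorizes over \<open>k\<close>, and each factor is at most \<open>1\<close>, given the covariate: by Hoeffding's
  lemma the noise costs \<open>2 B\<^sup>2 s\<^sup>2 \<lambda>\<^sup>2 d\<^sup>2\<close>, a multiple of \<open>d\<^sup>2\<close>, and it is absorbed by the joint
  drift \<open>-(\<lambda> - \<alpha>) s d\<^sup>2\<close> of the two exponents if the parameter \<open>s\<close> is small (\<open>one_step_mgf\<close>, \<open>product_mgf\<close>). The exponential is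
  first replaced by its chord, which is linear in \<open>y\<close>; so only the defining property of \<open>\<phi>\<^sub>k\<close> is
  needed, and no conditional distribution of \<open>Y\<^sub>k\<close> given \<open>X\<^sub>k\<close>.

  Covering. Since the factors are at most \<open>1\<close> given the covariates, the centres may depend on the
  covariates. They are chosen from a fixed finite grid, at the cost of doubling the radius, so that
  the choice is measurable and uses no more centres than the covering number
  (\<open>measurable_cover_selection\<close>). This also avoids any claim on the measurability of the covering
  number itself.
\<close>

section \<open>Truncation and exponential inequalities\<close>

lemma trunc_bounds: "0 \<le> B \<Longrightarrow> - B \<le> trunc B y" "0 \<le> B \<Longrightarrow> trunc B y \<le> B"
  by (auto simp: trunc_def)

lemma trunc_measurable [measurable]: "trunc B \<in> borel_measurable borel"
  unfolding trunc_def by measurable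

lemma trunc_id: "- B \<le> y \<Longrightarrow> y \<le> B \<Longrightarrow> trunc B y = y"
  by (auto simp: trunc_def)

lemma trunc_nonexpansive: "\<bar>trunc B y - trunc B y'\<bar> \<le> \<bar>y - y'\<bar>"
  by (auto simp: trunc_def min_def max_def)

text \<open>
  The chord over \<open>[-B, B]\<close> is linear in \<open>y\<close>. After this step the response enters an expectation only
  linearly, so that it can be replaced by its conditional mean.
\<close>

lemma exp_le_chord:
  fixes B t y :: real
  assumes "0 < B" "- B \<le> y" "y \<le> B"
  shows "exp (t * y) \<le> (B - y) / (2 * B) * exp (- (t * B)) + (B + y) / (2 * B) * exp (t * B)"
proof -
  have cv: "convex_on UNIV (exp :: real \<Rightarrow> real)"
    using convex_on_exp[of 1] by simp
  define r where "r = (B + y) / (2 * B)"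
  have r: "0 \<le> r" "r \<le> 1" "1 - r = (B - y) / (2 * B)"
    using assms by (auto simp: r_def field_simps)
  have "exp ((1 - r) *\<^sub>R (- (t * B)) + r *\<^sub>R (t * B)) \<le> (1 - r) * exp (- (t * B)) + r * exp (t * B)"
    using r by (intro convex_onD[OF cv]) auto
  moreover have "(1 - r) *\<^sub>R (- (t * B)) + r *\<^sub>R (t * B) = t * y"
    using assms by (simp add: r_def field_simps)
  ultimately show ?thesis
    unfolding r(3)[symmetric] r_def by simp
qed

text \<open>
  Hoeffding's lemma for the law on the two points \<open>-B\<close> and \<open>B\<close> with mean \<open>p\<close>, whose moment generating
  function is the chord at \<open>p\<close>. The known auxiliary inequality covers \<open>t \<ge> 0\<close>; the reflection
  \<open>(t, p) \<mapsto> (-t, -p)\<close> gives the rest.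
\<close>

lemma hoeffding_two_point:
  fixes B t p :: real
  assumes "0 < B" "- B \<le> p" "p \<le> B"
  shows "(B - p) / (2 * B) * exp (- (t * B)) + (B + p) / (2 * B) * exp (t * B)
    \<le> exp (t * p + t\<^sup>2 * B\<^sup>2 / 2)"
proof -
  have main: "(B - p) / (2 * B) * exp (- (t * B)) + (B + p) / (2 * B) * exp (t * B)
    \<le> exp (t * p + t\<^sup>2 * B\<^sup>2 / 2)"
    if "0 \<le> t" "- B \<le> p" "p \<le> B" for t p :: real
  proof -
    define r h where "r = (B + p) / (2 * B)" and "h = 2 * B * t"
    have r: "0 \<le> r" "(B - p) / (2 * B) = 1 - r" and h: "0 \<le> h"
      using that assms(1) by (auto simp: r_def h_def field_simps)
    have pos: "1 + r * (exp h - 1) > 0"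
      using r h by (intro add_pos_nonneg mult_nonneg_nonneg) auto
    have "ln (1 + r * (exp h - 1)) \<le> h * r + h\<^sup>2 / 8"
      using Hoeffdings_lemma_aux[OF h r(1)] by simp
    then have "1 + r * (exp h - 1) \<le> exp (h * r + h\<^sup>2 / 8)"
      using pos by (metis exp_le_cancel_iff exp_ln)
    then have "exp (- (t * B)) * (1 + r * (exp h - 1))
        \<le> exp (- (t * B)) * exp (h * r + h\<^sup>2 / 8)"
      by simp
    also have "\<dots> = exp (- (t * B) + (h * r + h\<^sup>2 / 8))"
      by (simp only: exp_add)
    also have "- (t * B) + (h * r + h\<^sup>2 / 8) = t * p + t\<^sup>2 * B\<^sup>2 / 2"
      using assms(1) by (simp add: r_def h_def field_simps power2_eq_square)
    also have "exp (- (t * B)) * (1 + r * (exp h - 1))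
        = (1 - r) * exp (- (t * B)) + r * (exp (- (t * B)) * exp h)"
      by (simp add: algebra_simps)
    also have "exp (- (t * B)) * exp h = exp (t * B)"
      by (simp add: h_def flip: exp_add)
    finally show ?thesis
      unfolding r(2) r_def by simp
  qed
  show ?thesis
  proof (cases "0 \<le> t")
    case True
    then show ?thesis using main assms by blast
  next
    case False
    then show ?thesis using main[of "- t" "- p"] assms by (simp add: algebra_simps)
  qed
qed

text \<open>
  Equality holds at \<open>u = 0\<close>. The first-order terms add up to \<open>-(x - y) u\<close>, and all terms of second
  order are bounded by \<open>2 x\<^sup>2 u\<close> since \<open>u \<le> 1\<close>.
\<close>

lemma exp_sum_le_two:
  fixes u x y :: real
  assumes u: "0 \<le> u" "u \<le> 1" and y: "0 \<le> y" "y \<le> x" "x \<le> 1" and xy: "2 * x\<^sup>2 \<le> x - y"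
  shows "exp (- (x * u) + x\<^sup>2 * u / 2) + exp (y * u) \<le> 2"
proof -
  define w where "w = x * u - x\<^sup>2 * u / 2"
  have x2: "x\<^sup>2 \<le> x" using y by (auto simp: power2_eq_square mult_left_le)
  have w0: "0 \<le> w"
  proof -
    have "x\<^sup>2 / 2 \<le> x" using x2 y by linarith
    then have "x\<^sup>2 / 2 * u \<le> x * u" using u by (intro mult_right_mono)
    then show ?thesis by (simp add: w_def)
  qed
  have wx: "w \<le> x * u" using u by (simp add: w_def)
  have "exp w \<ge> 1 + w + w\<^sup>2 / 2"
    using exp_lower_Taylor_quadratic[OF w0] by simp
  have expw: "exp (- w) \<le> 1 - w + w\<^sup>2 / 2"
  proof -
    have "1 \<le> (1 - w + w\<^sup>2 / 2) * (1 + w + w\<^sup>2 / 2)"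
      using w0 by (simp add: algebra_simps power2_eq_square)
    also have "\<dots> \<le> (1 - w + w\<^sup>2 / 2) * exp w"
    proof (rule mult_left_mono[OF \<open>exp w \<ge> 1 + w + w\<^sup>2 / 2\<close>])
      have "1 - w + w\<^sup>2 / 2 = ((1 - w)\<^sup>2 + 1) / 2" by (simp add: power2_eq_square algebra_simps add_divide_distrib diff_divide_distrib)
      then show "0 \<le> 1 - w + w\<^sup>2 / 2" by (smt (verit) zero_le_power2 divide_nonneg_nonneg)
    qed
    finally show ?thesis by (simp add: exp_minus field_simps)
  qed
  have xu: "(x * u)\<^sup>2 \<le> x\<^sup>2 * u"
    unfolding power_mult_distrib using u by (intro mult_left_mono) (auto simp: power2_eq_square mult_left_le)
  have "w\<^sup>2 \<le> (x * u)\<^sup>2" using wx w0 by (rule power_mono)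
  also have "\<dots> \<le> x\<^sup>2 * u"
    by (rule xu)
  finally have w2: "w\<^sup>2 \<le> x\<^sup>2 * u" .
  have yu: "0 \<le> y * u" "y * u \<le> 1" using u y by (auto simp: mult_le_one)
  have "exp (y * u) \<le> 1 + y * u + (y * u)\<^sup>2"
    using exp_bound[OF yu] by simp
  also have "(y * u)\<^sup>2 \<le> (x * u)\<^sup>2"
    using y u by (intro power_mono mult_right_mono) auto
  also have "(x * u)\<^sup>2 \<le> x\<^sup>2 * u"
    by (rule xu)
  finally have ey: "exp (y * u) \<le> 1 + y * u + x\<^sup>2 * u" by simp
  have "(2 * x\<^sup>2) * u \<le> (x - y) * u" using xy u by (intro mult_right_mono)
  moreover have "exp (- (x * u) + x\<^sup>2 * u / 2) = exp (- w)" by (simp add: w_def)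
  ultimately show ?thesis using expw ey w2 by (simp add: w_def algebra_simps)
qed

section \<open>One-sample exponential moments\<close>

text \<open>
  \<open>mu k\<close> is the law of the \<open>k\<close>-th observation. The assumption \<open>regression\<close> says that \<open>phi k\<close> is the
  regression function of the truncated response, tested against bounded functions of the covariate.
  The assumptions hold at every index of the type and not only in \<open>I\<close>, because product measures are
  formed from families over the whole index type.
\<close>

locale truncated_regression =
  fixes I :: "'i set" and mu :: "'i \<Rightarrow> ('a::polish_space \<times> real) measure"
    and phi :: "'i \<Rightarrow> 'a \<Rightarrow> real" and B lam :: real
  assumes finite_I: "finite I" and I_nonempty: "I \<noteq> {}"
    and prob_mu: "\<And>k. prob_space (mu k)"
    and sets_mu [measurable_cong]: "\<And>k. sets (mu k) = sets (borel \<Otimes>\<^sub>M borel)"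
    and B_pos: "0 < B" and lam_gt_1: "1 < lam"
    and phi_measurable [measurable]: "\<And>k. phi k \<in> borel_measurable borel"
    and phi_lower: "\<And>k x. - B \<le> phi k x" and phi_upper: "\<And>k x. phi k x \<le> B"
    and regression: "\<And>k u. u \<in> borel_measurable borel \<Longrightarrow> bounded (range u) \<Longrightarrow>
      (\<integral>z. u (fst z) * trunc B (snd z) \<partial>mu k) = (\<integral>z. u (fst z) * phi k (fst z) \<partial>mu k)"
begin

text \<open>
  The conditional mean, given the covariate \<open>x\<close>, of the excess loss at the prediction \<open>v\<close>; see
  \<open>integral_excess_at\<close>.
\<close>

definition sq_bias :: "'i \<Rightarrow> real \<Rightarrow> 'a \<Rightarrow> real" where
  "sq_bias k v x = (v - phi k x)\<^sup>2"

definition excess_at :: "'i \<Rightarrow> real \<Rightarrow> 'a \<times> real \<Rightarrow> real" where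
  "excess_at k v z = (v - trunc B (snd z))\<^sup>2 - (phi k (fst z) - trunc B (snd z))\<^sup>2"

text \<open>
  The factor \<open>\<alpha>\<close> in front of the ghost sample, a quarter of the way from \<open>1\<close> to \<open>lam\<close>. The drift
  \<open>lam - weight = 3 (lam - 1) / 4\<close> must dominate in \<open>two_term_mgf_le\<close>, while
  \<open>weight - 1 = (lam - 1) / 4\<close> is what \<open>ghost_condition\<close> uses.
\<close>

definition weight :: real where "weight = 1 + (lam - 1) / 4"

text \<open>
  The parameter \<open>s\<close> of the exponential moments. Multiplied by \<open>4 B\<^sup>2\<close>, the bound on \<open>d\<^sup>2\<close>, it
  is \<open>(lam - 1) / (3 lam\<^sup>3)\<close>: small enough for the drift to dominate in \<open>two_term_mgf_le\<close>, and large
  enough to exceed the required rate in \<open>rate_bound\<close>.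
\<close>

definition rate :: real where "rate = (lam - 1) / (12 * B\<^sup>2 * lam ^ 3)"

lemma rate_pos: "0 < rate" using lam_gt_1 B_pos by (simp add: rate_def)

lemma abs_phi: "\<bar>phi k x\<bar> \<le> B" using phi_lower[of k x] phi_upper[of k x] by linarith

lemma excess_at_eq: "excess_at k v z = v\<^sup>2 - (phi k (fst z))\<^sup>2 - 2 * (v - phi k (fst z)) * trunc B (snd z)"
  by (simp add: excess_at_def power2_eq_square algebra_simps)

text \<open>
  The two summands are the exponential moments of \<open>weight * d\<^sup>2\<close> and, after Hoeffding's lemma, of
  \<open>- lam * h\<close>. The exponent of the second is \<open>- rate * lam * d\<^sup>2 + 2 * (rate * lam * B * d)\<^sup>2\<close>, and with
  \<open>u = d\<^sup>2 / (4 B\<^sup>2)\<close> both exponents have the form treated in \<open>exp_sum_le_two\<close>.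
\<close>

lemma two_term_mgf_le:
  fixes v :: real and k :: 'i and x :: 'a
  assumes v: "\<bar>v\<bar> \<le> B"
  defines "d \<equiv> v - phi k x"
  shows "exp (rate * weight * d\<^sup>2) +
    exp (- (rate * lam * (v\<^sup>2 - (phi k x)\<^sup>2))) * exp ((2 * rate * lam * d) * phi k x + (2 * rate * lam * d)\<^sup>2 * B\<^sup>2 / 2) \<le> 2"
proof -
  define tau where "tau = (lam - 1) / (3 * lam ^ 3)"
  define u where "u = d\<^sup>2 / (4 * B\<^sup>2)"
  have rate: "rate = tau / (4 * B\<^sup>2)" by (simp add: rate_def tau_def)
  have "\<bar>d\<bar> \<le> 2 * B" using v abs_phi[of k x] unfolding d_def by linarith
  then have "d\<^sup>2 \<le> (2 * B)\<^sup>2" by (metis abs_le_square_iff abs_of_pos B_pos mult_pos_pos zero_less_numeral)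
  then have u: "0 \<le> u" "u \<le> 1" using B_pos by (auto simp: u_def power_mult_distrib)
  have tau: "0 < tau" using lam_gt_1 by (simp add: tau_def)
  have l3: "lam ^ 3 = lam * lam\<^sup>2" by (simp add: power2_eq_square power3_eq_cube)
  have lt: "lam\<^sup>2 * tau * 3 * lam = lam - 1" using lam_gt_1 by (simp add: tau_def l3 field_simps)
  have lt1: "lam * tau \<le> 1"
  proof -
    have "lam * tau * lam = (lam - 1) / (3 * lam)"
      using lam_gt_1 by (simp add: tau_def l3 field_simps power2_eq_square)
    also have "\<dots> \<le> 1" using lam_gt_1 by (simp add: field_simps)
    finally have "lam * tau \<le> 1 / lam" using lam_gt_1 by (simp add: field_simps)
    also have "\<dots> \<le> 1" using lam_gt_1 by (simp add: field_simps)
    finally show ?thesis .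
  qed
  have weight: "0 \<le> weight" "weight \<le> lam" using lam_gt_1 by (auto simp: weight_def field_simps)
  have "2 * (lam * tau)\<^sup>2 \<le> lam * tau - weight * tau"
  proof -
    have "2 * (lam * tau)\<^sup>2 = 2 * tau * (lam\<^sup>2 * tau)" by (simp add: power2_eq_square)
    also have "lam\<^sup>2 * tau = (lam - 1) / (3 * lam)" using lt lam_gt_1 by (simp add: field_simps)
    also have "\<dots> \<le> (lam - 1) / 3" using lam_gt_1 by (intro divide_left_mono) auto
    also have "2 * tau * ((lam - 1) / 3) \<le> 2 * tau * (3 * (lam - 1) / 8)"
      using tau lam_gt_1 by (intro mult_left_mono) (auto simp: field_simps)
    also have "\<dots> = lam * tau - weight * tau" by (simp add: weight_def field_simps)
    finally show ?thesis using tau by (simp add: mult_left_mono)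
  qed
  then have "exp (- (lam * tau * u) + (lam * tau)\<^sup>2 * u / 2) + exp (weight * tau * u) \<le> 2"
    using u weight tau lt1 by (intro exp_sum_le_two) (auto intro: mult_right_mono)
  moreover have "weight * tau * u = rate * weight * d\<^sup>2" by (simp add: rate u_def)
  moreover have "- (rate * lam * (v\<^sup>2 - (phi k x)\<^sup>2)) + ((2 * rate * lam * d) * phi k x + (2 * rate * lam * d)\<^sup>2 * B\<^sup>2 / 2)
     = - (lam * tau * u) + (lam * tau)\<^sup>2 * u / 2"
  proof -
    have "- (rate * lam * (v\<^sup>2 - (phi k x)\<^sup>2)) + (2 * rate * lam * d) * phi k x = - (rate * lam * d\<^sup>2)"
      by (simp add: d_def power2_eq_square algebra_simps)
    moreover have "rate * lam * d\<^sup>2 = lam * tau * u" by (simp add: rate u_def)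
    moreover have "(2 * rate * lam * d)\<^sup>2 * B\<^sup>2 / 2 = (lam * tau)\<^sup>2 * u / 2"
      using B_pos by (simp add: rate u_def power2_eq_square field_simps)
    ultimately show ?thesis by linarith
  qed
  ultimately show ?thesis by (simp add: add.commute flip: exp_add)
qed

text \<open>
  Testing against all weights \<open>u\<close> that depend on the covariate alone expresses that the conditional
  exponential moment given the covariate is at most \<open>1\<close>. The integrand is bounded by an expression
  that is linear in the truncated response, to which the regression property applies.
\<close>

lemma one_step_mgf:
  assumes u [measurable]: "u \<in> borel_measurable borel" and u1: "\<And>x. u x \<le> (1::ennreal)"
    and v: "\<bar>v\<bar> \<le> B"
  shows "(\<integral>\<^sup>+ z. u (fst z) * ennreal ((exp (rate * weight * sq_bias k v (fst z)) + exp (- (rate * lam * excess_at k v z))) / 2) \<partial>mu k)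
    \<le> (\<integral>\<^sup>+ z. u (fst z) \<partial>mu k)"
proof -
  interpret prob_space "mu k" by (rule prob_mu)
  \<comment> \<open>A real-valued version of the weight, to use Bochner integrals\<close>
  define w where "w x = enn2real (u x)" for x
  have [measurable]: "w \<in> borel_measurable borel" unfolding w_def by measurable
  have uw: "u x = ennreal (w x)" for x
    unfolding w_def by (rule ennreal_enn2real[symmetric]) (use u1[of x] in \<open>simp add: le_less_trans[of _ 1]\<close>)
  have w: "0 \<le> w x" "w x \<le> 1" for x
    using u1[of x] by (auto simp: w_def enn2real_leI)
  define t where "t x = 2 * rate * lam * (v - phi k x)" for x
  define a where "a x = exp (rate * weight * (v - phi k x)\<^sup>2)" for x
  define e where "e x = exp (- (rate * lam * (v\<^sup>2 - (phi k x)\<^sup>2)))" for x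
  define chord where "chord x y = (B - y) / (2 * B) * exp (- (t x * B)) + (B + y) / (2 * B) * exp (t x * B)" for x y
  define c1 where "c1 x = (exp (t x * B) - exp (- (t x * B))) / (2 * B)" for x
  have [measurable]: "t \<in> borel_measurable borel" "a \<in> borel_measurable borel"
    "e \<in> borel_measurable borel" "c1 \<in> borel_measurable borel"
    unfolding t_def a_def e_def c1_def by measurable
  have chord_eq: "chord x y = chord x 0 + c1 x * y" for x y
    using B_pos by (simp add: chord_def c1_def field_simps)
  have lampos: "0 < lam" using lam_gt_1 by simp
  have tb: "\<bar>t x * B\<bar> \<le> 4 * rate * lam * B\<^sup>2" for x
  proof -
    have "\<bar>t x * B\<bar> = 2 * rate * lam * B * \<bar>v - phi k x\<bar>"
      using rate_pos lampos B_pos by (simp add: t_def abs_mult)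
    also have "\<dots> \<le> 2 * rate * lam * B * (2 * B)"
      using rate_pos lampos B_pos v abs_phi[of k x] by (intro mult_left_mono) auto
    finally show ?thesis by (simp add: power2_eq_square)
  qed
  define R where "R = exp (4 * rate * lam * B\<^sup>2)"
  have R: "exp (t x * B) \<le> R" "exp (- (t x * B)) \<le> R" for x
    using tb[of x] by (auto simp: R_def)
  have eb: "e x \<le> exp (rate * lam * B\<^sup>2)" "0 \<le> e x" for x
  proof -
    have "(phi k x)\<^sup>2 \<le> B\<^sup>2" using abs_phi[of k x] B_pos by (metis abs_le_square_iff abs_of_pos)
    then have "- (v\<^sup>2 - (phi k x)\<^sup>2) \<le> B\<^sup>2" using zero_le_power2[of v] by linarith
    then have "rate * lam * (- (v\<^sup>2 - (phi k x)\<^sup>2)) \<le> rate * lam * B\<^sup>2"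
      using rate_pos lampos by (intro mult_left_mono) auto
    then show "e x \<le> exp (rate * lam * B\<^sup>2)" unfolding e_def exp_le_cancel_iff by (simp only: mult_minus_right)
  qed (simp add: e_def)
  have c1b: "\<bar>c1 x\<bar> \<le> R / (2 * B)" for x
    using R[of x] B_pos exp_gt_zero[of "t x * B"] exp_gt_zero[of "- (t x * B)"]
    unfolding c1_def abs_divide by (intro frac_le) linarith+
  have bd: "\<bar>w x * e x * c1 x\<bar> \<le> exp (rate * lam * B\<^sup>2) * (R / (2 * B))" for x
  proof -
    have "\<bar>w x * e x * c1 x\<bar> = w x * (e x * \<bar>c1 x\<bar>)"
      using w[of x] eb[of x] by (simp add: abs_mult)
    also have "\<dots> \<le> 1 * (exp (rate * lam * B\<^sup>2) * (R / (2 * B)))"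
      using w[of x] eb[of x] c1b[of x] by (intro mult_mono) auto
    finally show ?thesis by simp
  qed
  have arith: "a x + e x * chord x (phi k x) \<le> 2" for x
  proof -
    have "e x * chord x (phi k x) \<le> e x * exp (t x * phi k x + (t x)\<^sup>2 * B\<^sup>2 / 2)"
      unfolding chord_def using eb(2)[of x] B_pos phi_lower phi_upper by (intro mult_left_mono hoeffding_two_point) auto
    then show ?thesis using two_term_mgf_le[OF v, of k x] unfolding a_def e_def t_def by linarith
  qed
  have chord0: "0 \<le> chord x y" if "- B \<le> y" "y \<le> B" for x y
    using that B_pos by (auto simp: chord_def)
  have b1: "\<bar>w x * (a x + e x * chord x (phi k x))\<bar> \<le> 2" for x
  proof -
    have "0 \<le> a x + e x * chord x (phi k x)"
      using chord0[of "phi k x" x] phi_lower[of k x] phi_upper[of k x] eb(2)[of x] by (simp add: a_def)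
    then show ?thesis using arith[of x] w[of x] mult_mono[of "w x" 1 "a x + e x * chord x (phi k x)" 2]
      by (simp add: abs_mult)
  qed
  have i1: "integrable (mu k) (\<lambda>z. w (fst z) * (a (fst z) + e (fst z) * chord (fst z) (phi k (fst z))))"
  proof (rule integrable_const_bound[where B = 2])
    show "AE z in mu k. norm (w (fst z) * (a (fst z) + e (fst z) * chord (fst z) (phi k (fst z)))) \<le> 2"
      by (intro AE_I2) (simp only: real_norm_def b1)
    show "(\<lambda>z. w (fst z) * (a (fst z) + e (fst z) * chord (fst z) (phi k (fst z)))) \<in> borel_measurable (mu k)"
      unfolding chord_def by measurable
  qed
  have i2: "integrable (mu k) (\<lambda>z. w (fst z) * e (fst z) * c1 (fst z) * trunc B (snd z))"
  proof (rule integrable_const_bound[where B = "exp (rate * lam * B\<^sup>2) * (R / (2 * B)) * B"])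
    have "\<bar>w x * e x * c1 x * trunc B y\<bar> \<le> exp (rate * lam * B\<^sup>2) * (R / (2 * B)) * B" for x y
      unfolding abs_mult[of _ "trunc B y"] using trunc_bounds[of B y] B_pos
      by (intro mult_mono bd) (auto simp: abs_le_iff R_def)
    then show "AE z in mu k. norm (w (fst z) * e (fst z) * c1 (fst z) * trunc B (snd z)) \<le> exp (rate * lam * B\<^sup>2) * (R / (2 * B)) * B"
      by auto
  qed measurable
  have i3: "integrable (mu k) (\<lambda>z. w (fst z) * e (fst z) * c1 (fst z) * phi k (fst z))"
  proof (rule integrable_const_bound[where B = "exp (rate * lam * B\<^sup>2) * (R / (2 * B)) * B"])
    have "\<bar>w x * e x * c1 x * phi k x\<bar> \<le> exp (rate * lam * B\<^sup>2) * (R / (2 * B)) * B" for x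
      unfolding abs_mult[of _ "phi k x"] using abs_phi[of k x] B_pos
      by (intro mult_mono bd) (auto simp: abs_le_iff R_def)
    then show "AE z in mu k. norm (w (fst z) * e (fst z) * c1 (fst z) * phi k (fst z)) \<le> exp (rate * lam * B\<^sup>2) * (R / (2 * B)) * B"
      by auto
  qed measurable
  \<comment> \<open>Separates the part that is linear in the response, centred at the conditional mean\<close>
  have split: "w x * (a x + e x * chord x y) = w x * (a x + e x * chord x (phi k x)) - w x * e x * c1 x * phi k x + w x * e x * c1 x * y" for x y
    by (subst (1 2) chord_eq) (simp add: algebra_simps)
  have i4: "integrable (mu k) (\<lambda>z. w (fst z) * (a (fst z) + e (fst z) * chord (fst z) (trunc B (snd z))))"
    unfolding split[of _ "trunc B _"] using i1 i2 i3 by (intro Bochner_Integration.integrable_add Bochner_Integration.integrable_diff)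
  have bw: "bounded (range (\<lambda>x. w x * e x * c1 x))"
    using bd by (auto simp: bounded_iff)
  have eq: "(\<integral>z. w (fst z) * (a (fst z) + e (fst z) * chord (fst z) (trunc B (snd z))) \<partial>mu k)
     = (\<integral>z. w (fst z) * (a (fst z) + e (fst z) * chord (fst z) (phi k (fst z))) \<partial>mu k)"
    unfolding split[of _ "trunc B _"] using i1 i2 i3 regression[OF _ bw, of k] by simp
  have iw: "integrable (mu k) (\<lambda>z. w (fst z))"
    using w by (intro integrable_const_bound[where B = 1]) auto
  have "(\<integral>\<^sup>+ z. u (fst z) * ennreal ((exp (rate * weight * sq_bias k v (fst z)) + exp (- (rate * lam * excess_at k v z))) / 2) \<partial>mu k)
    \<le> (\<integral>\<^sup>+ z. ennreal (w (fst z) * (a (fst z) + e (fst z) * chord (fst z) (trunc B (snd z))) / 2) \<partial>mu k)"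
  proof (rule nn_integral_mono)
    fix z :: "'a \<times> real"
    have "exp (- (rate * lam * excess_at k v z)) = e (fst z) * exp (t (fst z) * trunc B (snd z))"
      unfolding excess_at_eq e_def t_def by (simp add: algebra_simps flip: exp_add)
    also have "\<dots> \<le> e (fst z) * chord (fst z) (trunc B (snd z))"
      unfolding chord_def using B_pos trunc_bounds eb(2) by (intro mult_left_mono exp_le_chord) auto
    finally show "u (fst z) * ennreal ((exp (rate * weight * sq_bias k v (fst z)) + exp (- (rate * lam * excess_at k v z))) / 2)
      \<le> ennreal (w (fst z) * (a (fst z) + e (fst z) * chord (fst z) (trunc B (snd z))) / 2)"
      unfolding uw using w[of "fst z"]
      by (subst ennreal_mult[symmetric]) (auto simp: a_def sq_bias_def intro!: ennreal_leI mult_left_mono divide_right_mono simp flip: times_divide_eq_right)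
  qed
  also have "\<dots> = ennreal ((\<integral>z. w (fst z) * (a (fst z) + e (fst z) * chord (fst z) (trunc B (snd z))) \<partial>mu k) / 2)"
    using i4 w chord0 eb(2) trunc_bounds B_pos
    by (subst nn_integral_eq_integral) (auto simp: a_def intro!: AE_I2 mult_nonneg_nonneg add_nonneg_nonneg)
  also have "\<dots> \<le> ennreal ((\<integral>z. 2 * w (fst z) \<partial>mu k) / 2)"
    unfolding eq
  proof (intro ennreal_leI divide_right_mono integral_mono i1)
    show "w (fst z) * (a (fst z) + e (fst z) * chord (fst z) (phi k (fst z))) \<le> 2 * w (fst z)" for z :: "'a \<times> real"
      using mult_left_mono[OF arith[of "fst z"] w(1)[of "fst z"]] by simp
  qed (use iw in auto)
  also have "\<dots> = (\<integral>\<^sup>+ z. u (fst z) \<partial>mu k)"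
    unfolding uw using iw w by (subst nn_integral_eq_integral) auto
  finally show ?thesis .
qed


sublocale product_prob_space mu I
  by (intro product_prob_spaceI prob_mu)

lemma excess_at_measurable [measurable (raw)]:
  assumes [measurable]: "f \<in> borel_measurable M" "g \<in> measurable M (borel \<Otimes>\<^sub>M borel)"
  shows "(\<lambda>x. excess_at k (f x) (g x)) \<in> borel_measurable M"
  unfolding excess_at_def by measurable

lemma sq_bias_measurable [measurable (raw)]:
  assumes [measurable]: "f \<in> borel_measurable M" "g \<in> borel_measurable M"
  shows "(\<lambda>x. sq_bias k (f x) (g x)) \<in> borel_measurable M"
  unfolding sq_bias_def by measurable

text \<open>
  The factor that index \<open>k\<close> contributes to the average over all \<open>J\<close> of the exponential moments of
  \<open>mixed_deviation J\<close>: the first term for \<open>k \<in> J\<close>, the second for \<open>k \<notin> J\<close>.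
\<close>

definition tilt :: "'i \<Rightarrow> real \<Rightarrow> 'a \<times> real \<Rightarrow> real" where
  "tilt k v z = (exp (rate * weight * sq_bias k v (fst z)) + exp (- (rate * lam * excess_at k v z))) / 2"

lemma tilt_measurable [measurable]: "tilt k v \<in> borel_measurable (borel \<Otimes>\<^sub>M borel)"
  unfolding tilt_def by measurable

lemma tilt_pos: "0 < tilt k v z"
  by (simp add: tilt_def add_pos_pos)

definition covariates :: "'i set \<Rightarrow> ('i \<Rightarrow> 'a \<times> real) \<Rightarrow> 'i \<Rightarrow> 'a" where
  "covariates J z = (\<lambda>k\<in>J. fst (z k))"

lemma covariates_measurable [measurable]: "covariates J \<in> measurable (PiM J mu) (PiM J (\<lambda>_. borel))"
  unfolding covariates_def by measurable

lemma covariates_apply [simp]: "k \<in> J \<Longrightarrow> covariates J z k = fst (z k)"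
  by (simp add: covariates_def)

text \<open>
  Integrating one coordinate at a time: the weight \<open>w\<close> with the \<open>i\<close>-th covariate integrated out is
  again a weight in the remaining covariates with values at most \<open>1\<close>.
\<close>

lemma product_mgf:
  assumes "finite J" "w \<in> borel_measurable (PiM J (\<lambda>_. borel))" "\<And>x. w x \<le> (1::ennreal)"
    and v: "\<And>k. k \<in> J \<Longrightarrow> \<bar>v k\<bar> \<le> B"
  shows "(\<integral>\<^sup>+ z. w (covariates J z) * (\<Prod>k\<in>J. ennreal (tilt k (v k) (z k))) \<partial>PiM J mu)
    \<le> (\<integral>\<^sup>+ z. w (covariates J z) \<partial>PiM J mu)"
  using assms
proof (induction J arbitrary: w rule: finite_induct)
  case empty
  then show ?case by simp
next
  case (insert i J w)
  note [measurable] = insert.prems(1)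
  define W where "W x = (\<integral>\<^sup>+ y. w (x(i := fst y)) \<partial>mu i)" for x
  have [measurable]: "(\<lambda>(x, a). x(i := a)) \<in> measurable (PiM J (\<lambda>_. borel) \<Otimes>\<^sub>M borel) (PiM (insert i J) (\<lambda>_. borel::'a measure))"
    by (rule measurable_add_dim)
  have [measurable]: "(\<lambda>(x, y). w (x(i := fst y))) \<in> borel_measurable (PiM J (\<lambda>_. borel) \<Otimes>\<^sub>M mu i)"
  proof -
    have "(\<lambda>(x, y). w (x(i := fst y))) = w \<circ> (\<lambda>(x, a). x(i := a)) \<circ> (\<lambda>(x, y). (x, fst y))"
      by (auto simp: fun_eq_iff)
    moreover have "w \<circ> (\<lambda>(x, a). x(i := a)) \<circ> (\<lambda>(x, y). (x, fst y)) \<in> borel_measurable (PiM J (\<lambda>_. borel) \<Otimes>\<^sub>M mu i)"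
      by measurable
    ultimately show ?thesis by metis
  qed
  have Wm: "W \<in> borel_measurable (PiM J (\<lambda>_. borel))"
    unfolding W_def by measurable
  have W1: "W x \<le> 1" for x
  proof -
    have "W x \<le> (\<integral>\<^sup>+ y. 1 \<partial>mu i)" unfolding W_def by (intro nn_integral_mono insert.prems)
    then show ?thesis using prob_space.emeasure_space_1[OF prob_mu[of i]] by simp
  qed
  have des: "covariates (insert i J) (z(i := y)) = (covariates J z)(i := fst y)" for z y
    using insert.hyps by (auto simp: covariates_def fun_eq_iff)
  have prd: "(\<Prod>k\<in>J. ennreal (tilt k (v k) ((z(i := y)) k))) = (\<Prod>k\<in>J. ennreal (tilt k (v k) (z k)))" for z y
    using insert.hyps by (intro prod.cong) auto
  have "(\<integral>\<^sup>+ z. w (covariates (insert i J) z) * (\<Prod>k\<in>insert i J. ennreal (tilt k (v k) (z k))) \<partial>PiM (insert i J) mu)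
    = (\<integral>\<^sup>+ z. (\<integral>\<^sup>+ y. w ((covariates J z)(i := fst y)) * ennreal (tilt i (v i) y) * (\<Prod>k\<in>J. ennreal (tilt k (v k) (z k))) \<partial>mu i) \<partial>PiM J mu)"
    using insert.hyps
    by (subst product_nn_integral_insert) (auto simp: des prd mult.assoc simp del: fun_upd_apply simp add: fun_upd_same intro!: nn_integral_cong)
  also have "\<dots> \<le> (\<integral>\<^sup>+ z. W (covariates J z) * (\<Prod>k\<in>J. ennreal (tilt k (v k) (z k))) \<partial>PiM J mu)"
  proof (rule nn_integral_mono)
    fix z assume z: "z \<in> space (PiM J mu)"
    then have dz: "covariates J z \<in> space (PiM J (\<lambda>_. borel))"
      by (auto simp: covariates_def space_PiM)
    have um: "(\<lambda>a. w ((covariates J z)(i := a))) \<in> borel_measurable borel"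
    proof -
      have "(\<lambda>a. (covariates J z)(i := a)) \<in> measurable borel (PiM (insert i J) (\<lambda>_. borel::'a measure))"
        using dz by (intro measurable_fun_upd[where J = J]) auto
      then show ?thesis by measurable
    qed
    have "(\<integral>\<^sup>+ y. w ((covariates J z)(i := fst y)) * ennreal (tilt i (v i) y) * (\<Prod>k\<in>J. ennreal (tilt k (v k) (z k))) \<partial>mu i)
       = (\<integral>\<^sup>+ y. w ((covariates J z)(i := fst y)) * ennreal (tilt i (v i) y) \<partial>mu i) * (\<Prod>k\<in>J. ennreal (tilt k (v k) (z k)))"
    proof (intro nn_integral_multc borel_measurable_times_ennreal)
      show "(\<lambda>y. w ((covariates J z)(i := fst y))) \<in> borel_measurable (mu i)"
        by (rule measurable_compose[OF _ um]) measurable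
      show "(\<lambda>y. ennreal (tilt i (v i) y)) \<in> borel_measurable (mu i)"
        by measurable
    qed
    also have "\<dots> \<le> W (covariates J z) * (\<Prod>k\<in>J. ennreal (tilt k (v k) (z k)))"
      unfolding W_def tilt_def
      by (intro mult_right_mono one_step_mgf[where u = "\<lambda>a. w ((covariates J z)(i := a))"] um insert.prems) auto
    finally show "(\<integral>\<^sup>+ y. w ((covariates J z)(i := fst y)) * ennreal (tilt i (v i) y) * (\<Prod>k\<in>J. ennreal (tilt k (v k) (z k))) \<partial>mu i)
      \<le> W (covariates J z) * (\<Prod>k\<in>J. ennreal (tilt k (v k) (z k)))" .
  qed
  also have "\<dots> \<le> (\<integral>\<^sup>+ z. W (covariates J z) \<partial>PiM J mu)"
    by (intro insert.IH Wm W1) (use insert.prems in auto)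
  also have "\<dots> = (\<integral>\<^sup>+ z. w (covariates (insert i J) z) \<partial>PiM (insert i J) mu)"
    using insert.hyps by (subst product_nn_integral_insert) (auto simp: des W_def)
  finally show ?case .
qed

abbreviation sample :: "('i \<Rightarrow> 'a \<times> real) measure" where "sample \<equiv> PiM I mu"

text \<open>
  The one-sample statistic that remains after the observations with index in \<open>J\<close> have been swapped
  with those of a ghost sample. The predictions \<open>v\<close> are a vector, so that the values of a function at
  the covariates and the centres of a cover are treated alike.
\<close>

definition mixed_deviation :: "'i set \<Rightarrow> ('i \<Rightarrow> real) \<Rightarrow> ('i \<Rightarrow> 'a \<times> real) \<Rightarrow> real" where
  "mixed_deviation J v z = (\<Sum>k\<in>J. weight * sq_bias k (v k) (fst (z k))) - (\<Sum>k\<in>I - J. lam * excess_at k (v k) (z k))"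

lemma exp_mixed_deviation:
  assumes "J \<subseteq> I"
  shows "exp (rate * mixed_deviation J v z) =
    (\<Prod>k\<in>J. exp (rate * weight * sq_bias k (v k) (fst (z k)))) * (\<Prod>k\<in>I - J. exp (- (rate * lam * excess_at k (v k) (z k))))"
proof -
  have "finite J" using assms finite_I finite_subset by blast
  then show ?thesis
    using finite_I by (simp add: mixed_deviation_def sum_distrib_left algebra_simps exp_diff exp_sum exp_minus prod_inversef inverse_eq_divide prod_dividef)
qed

lemma sum_exp_mixed_deviation:
  "(\<Sum>J\<in>Pow I. exp (rate * mixed_deviation J v z)) = 2 ^ card I * (\<Prod>k\<in>I. tilt k (v k) (z k))"
proof -
  have "(\<Sum>J\<in>Pow I. exp (rate * mixed_deviation J v z)) =
     (\<Prod>k\<in>I. exp (rate * weight * sq_bias k (v k) (fst (z k))) + exp (- (rate * lam * excess_at k (v k) (z k))))"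
    unfolding prod_add[OF finite_I] by (intro sum.cong) (auto simp: exp_mixed_deviation)
  also have "\<dots> = (\<Prod>k\<in>I. 2 * tilt k (v k) (z k))"
    unfolding tilt_def by (intro prod.cong) simp_all
  finally show ?thesis by (simp add: prod.distrib)
qed

lemma mixed_deviation_measurable:
  assumes "J \<subseteq> I" "\<And>k. k \<in> I \<Longrightarrow> (\<lambda>z. v z k) \<in> borel_measurable sample"
  shows "(\<lambda>z. mixed_deviation J (v z) z) \<in> borel_measurable sample"
proof -
  have "(\<lambda>z. sq_bias k (v z k) (fst (z k))) \<in> borel_measurable sample" "(\<lambda>z. excess_at k (v z k) (z k)) \<in> borel_measurable sample"
    if "k \<in> I" for k
    using assms(2)[OF that] that by measurable
  then show ?thesis
    unfolding mixed_deviation_def using assms(1)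
    by (intro borel_measurable_diff borel_measurable_sum borel_measurable_times) auto
qed

text \<open>
  The average over \<open>J\<close> turns the products over \<open>J\<close> and \<open>I - J\<close> into a product of two-term factors,
  by expanding the product of sums.
\<close>

lemma averaged_mgf:
  assumes w [measurable]: "w \<in> borel_measurable (PiM I (\<lambda>_. borel))" and w1: "\<And>x. w x \<le> (1::ennreal)"
    and v: "\<And>k. k \<in> I \<Longrightarrow> \<bar>v k\<bar> \<le> B"
  shows "(\<Sum>J\<in>Pow I. \<integral>\<^sup>+ z. w (covariates I z) * ennreal (exp (rate * mixed_deviation J v z)) \<partial>sample)
    \<le> 2 ^ card I * (\<integral>\<^sup>+ z. w (covariates I z) \<partial>sample)"
proof -
  have m: "(\<lambda>z. mixed_deviation J v z) \<in> borel_measurable sample" if "J \<subseteq> I" for J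
    using mixed_deviation_measurable[OF that, of "\<lambda>_. v"] by simp
  have "(\<Sum>J\<in>Pow I. \<integral>\<^sup>+ z. w (covariates I z) * ennreal (exp (rate * mixed_deviation J v z)) \<partial>sample)
    = (\<integral>\<^sup>+ z. (\<Sum>J\<in>Pow I. w (covariates I z) * ennreal (exp (rate * mixed_deviation J v z))) \<partial>sample)"
    using m by (intro nn_integral_sum[symmetric]) auto
  also have "\<dots> = (\<integral>\<^sup>+ z. 2 ^ card I * (w (covariates I z) * (\<Prod>k\<in>I. ennreal (tilt k (v k) (z k)))) \<partial>sample)"
  proof (intro nn_integral_cong)
    fix z
    have "(\<Sum>J\<in>Pow I. w (covariates I z) * ennreal (exp (rate * mixed_deviation J v z))) = w (covariates I z) * ennreal (\<Sum>J\<in>Pow I. exp (rate * mixed_deviation J v z))"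
      by (simp add: sum_distrib_left[symmetric] sum_ennreal)
    also have "\<dots> = w (covariates I z) * (2 ^ card I * (\<Prod>k\<in>I. ennreal (tilt k (v k) (z k))))"
      unfolding sum_exp_mixed_deviation
      by (subst ennreal_mult) (auto simp: prod_ennreal tilt_pos less_imp_le prod_nonneg simp flip: ennreal_power)
    finally show "(\<Sum>J\<in>Pow I. w (covariates I z) * ennreal (exp (rate * mixed_deviation J v z))) = 2 ^ card I * (w (covariates I z) * (\<Prod>k\<in>I. ennreal (tilt k (v k) (z k))))"
      by (simp add: ac_simps)
  qed
  also have "\<dots> = 2 ^ card I * (\<integral>\<^sup>+ z. w (covariates I z) * (\<Prod>k\<in>I. ennreal (tilt k (v k) (z k))) \<partial>sample)"
    by (intro nn_integral_cmult) measurable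
  also have "\<dots> \<le> 2 ^ card I * (\<integral>\<^sup>+ z. w (covariates I z) \<partial>sample)"
    by (intro mult_left_mono product_mgf finite_I w w1 v) auto
  finally show ?thesis .
qed

text \<open>
  A square \<open>(v - y)\<^sup>2\<close> with both arguments in \<open>[-B, B]\<close> has slope at most \<open>4 B\<close>, and \<open>weight \<le> lam\<close>.
\<close>

lemma mixed_lipschitz:
  assumes J: "J \<subseteq> I" and v: "\<And>k. k \<in> I \<Longrightarrow> \<bar>v k\<bar> \<le> B" and l: "\<And>k. k \<in> I \<Longrightarrow> \<bar>l k\<bar> \<le> B"
  shows "mixed_deviation J v z \<le> mixed_deviation J l z + 4 * B * lam * (\<Sum>k\<in>I. \<bar>l k - v k\<bar>)"
proof -
  have finJ: "finite J" using J finite_I finite_subset by blast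
  have lip: "\<bar>(a - y)\<^sup>2 - (b - y)\<^sup>2\<bar> \<le> 4 * B * \<bar>b - a\<bar>" if "\<bar>a\<bar> \<le> B" "\<bar>b\<bar> \<le> B" "\<bar>y\<bar> \<le> B" for a b y
  proof -
    have "(a - y)\<^sup>2 - (b - y)\<^sup>2 = (a - b) * (a + b - 2 * y)"
      by (simp add: power2_eq_square algebra_simps)
    then have "\<bar>(a - y)\<^sup>2 - (b - y)\<^sup>2\<bar> = \<bar>b - a\<bar> * \<bar>a + b - 2 * y\<bar>" by (simp add: abs_mult abs_minus_commute)
    also have "\<dots> \<le> \<bar>b - a\<bar> * (4 * B)" using that by (intro mult_left_mono) linarith+
    finally show ?thesis by (simp add: mult.commute)
  qed
  have weight: "0 \<le> weight" "weight \<le> lam" using lam_gt_1 by (auto simp: weight_def field_simps)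
  have g: "weight * sq_bias k (v k) x \<le> weight * sq_bias k (l k) x + 4 * B * lam * \<bar>l k - v k\<bar>" if "k \<in> I" for k x
  proof -
    have "sq_bias k (v k) x - sq_bias k (l k) x \<le> 4 * B * \<bar>l k - v k\<bar>"
      using lip[OF v[OF that] l[OF that] abs_phi, of k x] by (simp add: sq_bias_def abs_le_iff)
    then have "weight * (sq_bias k (v k) x - sq_bias k (l k) x) \<le> weight * (4 * B * \<bar>l k - v k\<bar>)"
      using weight by (intro mult_left_mono) auto
    also have "\<dots> \<le> lam * (4 * B * \<bar>l k - v k\<bar>)"
      using weight B_pos by (intro mult_right_mono) auto
    finally show ?thesis by (simp add: algebra_simps)
  qed
  have e: "lam * excess_at k (l k) y \<le> lam * excess_at k (v k) y + 4 * B * lam * \<bar>l k - v k\<bar>" if "k \<in> I" for k y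
  proof -
    have "excess_at k (l k) y - excess_at k (v k) y \<le> 4 * B * \<bar>l k - v k\<bar>"
      using lip[OF l[OF that] v[OF that], of "trunc B (snd y)"] trunc_bounds[of B "snd y"] B_pos
      by (simp add: excess_at_def abs_le_iff abs_minus_commute)
    then have "lam * (excess_at k (l k) y - excess_at k (v k) y) \<le> lam * (4 * B * \<bar>l k - v k\<bar>)"
      using lam_gt_1 by (intro mult_left_mono) auto
    then show ?thesis by (simp add: algebra_simps)
  qed
  have "(\<Sum>k\<in>J. weight * sq_bias k (v k) (fst (z k))) \<le> (\<Sum>k\<in>J. weight * sq_bias k (l k) (fst (z k)) + 4 * B * lam * \<bar>l k - v k\<bar>)"
    using J by (intro sum_mono g) auto
  moreover have "(\<Sum>k\<in>I - J. lam * excess_at k (l k) (z k)) \<le> (\<Sum>k\<in>I - J. lam * excess_at k (v k) (z k) + 4 * B * lam * \<bar>l k - v k\<bar>)"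
    by (intro sum_mono e) auto
  moreover have "(\<Sum>k\<in>J. 4 * B * lam * \<bar>l k - v k\<bar>) + (\<Sum>k\<in>I - J. 4 * B * lam * \<bar>l k - v k\<bar>) = 4 * B * lam * (\<Sum>k\<in>I. \<bar>l k - v k\<bar>)"
    unfolding sum_distrib_left by (subst sum.subset_diff[OF J finite_I]) (simp add: add.commute)
  ultimately show ?thesis by (simp add: mixed_deviation_def sum.distrib)
qed

text \<open>
  The union bound is taken over the centres that \<open>sel\<close> selects for the observed covariates. Writing it
  as a sum over all of \<open>V\<close>, weighted with the indicator of selection, makes each summand an instance
  of \<open>averaged_mgf\<close>; the indicators add up to the number of selected centres.
\<close>

lemma mixed_union_bound:
  assumes F: "countable F" "F \<subseteq> borel_measurable borel" "\<And>f x. f \<in> F \<Longrightarrow> \<bar>f x\<bar> \<le> B"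
    and V: "finite V" "\<And>l k. l \<in> V \<Longrightarrow> k \<in> I \<Longrightarrow> \<bar>l k\<bar> \<le> B"
    and sel [measurable]: "\<And>l. l \<in> V \<Longrightarrow> {x \<in> space (PiM I (\<lambda>_. borel)). l \<in> sel x} \<in> sets (PiM I (\<lambda>_. borel))"
    and sub: "\<And>x. sel x \<subseteq> V"
    and cover: "\<And>x f. f \<in> F \<Longrightarrow> \<exists>l\<in>sel x. (\<Sum>k\<in>I. \<bar>l k - f (x k)\<bar>) \<le> rho"
  shows "(\<Sum>J\<in>Pow I. emeasure sample {z \<in> space sample. \<exists>f\<in>F. t < mixed_deviation J (\<lambda>k. f (fst (z k))) z})
    \<le> 2 ^ card I * (ennreal (exp (- (rate * (t - 4 * B * lam * rho)))) * (\<integral>\<^sup>+ z. of_nat (card (sel (covariates I z))) \<partial>sample))"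
proof -
  define c where "c = ennreal (exp (- (rate * (t - 4 * B * lam * rho))))"
  define w :: "('i \<Rightarrow> real) \<Rightarrow> ('i \<Rightarrow> 'a) \<Rightarrow> ennreal"
    where "w l x = indicator {x \<in> space (PiM I (\<lambda>_. borel)). l \<in> sel x} x" for l x
  have w [measurable]: "w l \<in> borel_measurable (PiM I (\<lambda>_. borel))" if "l \<in> V" for l
    unfolding w_def using sel[OF that] by measurable
  have m [measurable]: "mixed_deviation J v \<in> borel_measurable sample" if "J \<subseteq> I" for J v
    using mixed_deviation_measurable[OF that, of "\<lambda>_. v"] by simp
  have "(\<Sum>J\<in>Pow I. emeasure sample {z \<in> space sample. \<exists>f\<in>F. t < mixed_deviation J (\<lambda>k. f (fst (z k))) z})
     \<le> (\<Sum>J\<in>Pow I. \<Sum>l\<in>V. c * (\<integral>\<^sup>+ z. w l (covariates I z) * ennreal (exp (rate * mixed_deviation J l z)) \<partial>sample))"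
  proof (rule sum_mono)
    fix J assume "J \<in> Pow I"
    then have J: "J \<subseteq> I" by simp
    let ?E = "{z \<in> space sample. \<exists>f\<in>F. t < mixed_deviation J (\<lambda>k. f (fst (z k))) z}"
    have "(\<lambda>z. mixed_deviation J (\<lambda>k. f (fst (z k))) z) \<in> borel_measurable sample" if "f \<in> F" for f
    proof (rule mixed_deviation_measurable[OF J])
      fix k assume [measurable]: "k \<in> I"
      have [measurable]: "f \<in> borel_measurable borel" using F that by auto
      show "(\<lambda>z. f (fst (z k))) \<in> borel_measurable sample" by measurable
    qed
    then have E: "?E \<in> sets sample"
      using F(1) by (intro predE pred_intros_countable_bounded) (auto intro: borel_measurable_pred_less)
    have "emeasure sample ?E = (\<integral>\<^sup>+ z. indicator ?E z \<partial>sample)" using E by simp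
    also have "\<dots> \<le> (\<integral>\<^sup>+ z. (\<Sum>l\<in>V. c * (w l (covariates I z) * ennreal (exp (rate * mixed_deviation J l z)))) \<partial>sample)"
    proof (rule nn_integral_mono)
      fix z assume z: "z \<in> space sample"
      show "indicator ?E z \<le> (\<Sum>l\<in>V. c * (w l (covariates I z) * ennreal (exp (rate * mixed_deviation J l z))))"
      proof (cases "z \<in> ?E")
        case True
        then obtain f where f: "f \<in> F" "t < mixed_deviation J (\<lambda>k. f (fst (z k))) z" by auto
        obtain l where l: "l \<in> sel (covariates I z)" "(\<Sum>k\<in>I. \<bar>l k - f (covariates I z k)\<bar>) \<le> rho"
          using cover[OF f(1)] by blast
        have lV: "l \<in> V" using l sub by auto
        have "mixed_deviation J (\<lambda>k. f (fst (z k))) z \<le> mixed_deviation J l z + 4 * B * lam * (\<Sum>k\<in>I. \<bar>l k - f (fst (z k))\<bar>)"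
          using V(2)[OF lV] F(3)[OF f(1)] by (intro mixed_lipschitz J) auto
        also have "\<dots> \<le> mixed_deviation J l z + 4 * B * lam * rho"
          using l(2) B_pos lam_gt_1 by (intro add_left_mono mult_left_mono) (auto simp: covariates_def)
        finally have "0 \<le> rate * (mixed_deviation J l z - (t - 4 * B * lam * rho))" using f(2) rate_pos by simp
        then have "1 \<le> exp (- (rate * (t - 4 * B * lam * rho))) * exp (rate * mixed_deviation J l z)"
          by (simp add: algebra_simps flip: exp_add)
        then have "1 \<le> c * ennreal (exp (rate * mixed_deviation J l z))"
          unfolding c_def by (subst ennreal_mult[symmetric]) (auto simp flip: ennreal_1 intro: ennreal_leI)
        moreover have "covariates I z \<in> space (PiM I (\<lambda>_. borel))"
          using z by (auto simp: covariates_def space_PiM)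
        then have "w l (covariates I z) = 1" using l(1) by (simp add: w_def)
        ultimately have "1 \<le> c * (w l (covariates I z) * ennreal (exp (rate * mixed_deviation J l z)))" by simp
        also have "\<dots> \<le> (\<Sum>l\<in>V. c * (w l (covariates I z) * ennreal (exp (rate * mixed_deviation J l z))))"
          using V(1) lV by (intro member_le_sum) auto
        finally show ?thesis using True by simp
      qed simp
    qed
    also have "\<dots> = (\<Sum>l\<in>V. (\<integral>\<^sup>+ z. c * (w l (covariates I z) * ennreal (exp (rate * mixed_deviation J l z))) \<partial>sample))"
      using J by (intro nn_integral_sum) measurable
    also have "\<dots> = (\<Sum>l\<in>V. c * (\<integral>\<^sup>+ z. w l (covariates I z) * ennreal (exp (rate * mixed_deviation J l z)) \<partial>sample))"
      using J by (intro sum.cong nn_integral_cmult refl) measurable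
    finally show "emeasure sample ?E \<le> (\<Sum>l\<in>V. c * (\<integral>\<^sup>+ z. w l (covariates I z) * ennreal (exp (rate * mixed_deviation J l z)) \<partial>sample))" .
  qed
  also have "\<dots> = (\<Sum>l\<in>V. c * (\<Sum>J\<in>Pow I. \<integral>\<^sup>+ z. w l (covariates I z) * ennreal (exp (rate * mixed_deviation J l z)) \<partial>sample))"
    by (subst sum.swap) (simp add: sum_distrib_left)
  also have "\<dots> \<le> (\<Sum>l\<in>V. c * (2 ^ card I * (\<integral>\<^sup>+ z. w l (covariates I z) \<partial>sample)))"
    using w V by (intro sum_mono mult_left_mono averaged_mgf) (auto simp: w_def indicator_def)
  also have "\<dots> = 2 ^ card I * (c * (\<Sum>l\<in>V. \<integral>\<^sup>+ z. w l (covariates I z) \<partial>sample))"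
    by (simp add: sum_distrib_left ac_simps)
  also have "(\<Sum>l\<in>V. \<integral>\<^sup>+ z. w l (covariates I z) \<partial>sample) = (\<integral>\<^sup>+ z. (\<Sum>l\<in>V. w l (covariates I z)) \<partial>sample)"
    using w by (intro nn_integral_sum[symmetric]) measurable
  also have "\<dots> = (\<integral>\<^sup>+ z. of_nat (card (sel (covariates I z))) \<partial>sample)"
  proof (rule nn_integral_cong)
    fix z assume "z \<in> space sample"
    then have "covariates I z \<in> space (PiM I (\<lambda>_. borel))" by (auto simp: covariates_def space_PiM)
    then have "(\<Sum>l\<in>V. w l (covariates I z)) = (\<Sum>l\<in>V. indicator (sel (covariates I z)) l)"
      by (intro sum.cong) (auto simp: w_def indicator_def)
    also have "\<dots> = of_nat (card (sel (covariates I z)))"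
      using V(1) sub[of "covariates I z"] by (simp add: sum_indicator_eq_card Int_absorb1 Int_absorb2 indicator_def sum.If_cases)
    finally show "(\<Sum>l\<in>V. w l (covariates I z)) = of_nat (card (sel (covariates I z)))" .
  qed
  finally show ?thesis unfolding c_def .
qed


section \<open>The lower tail of a ghost sample\<close>

lemma integral_coordinate:
  fixes g :: "'a \<times> real \<Rightarrow> real"
  assumes "k \<in> I" "g \<in> borel_measurable (mu k)"
  shows "(\<integral>z. g (z k) \<partial>sample) = (\<integral>y. g y \<partial>mu k)"
  using integral_distr[of "\<lambda>z. z k" sample "mu k" g] PiM_component[OF assms(1)] assms by simp

text \<open>
  Two coordinates of a product measure are uncorrelated: the product of the two functions is a
  product over all of \<open>I\<close> in which the other factors are \<open>1\<close>.
\<close>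

lemma integral_pair_zero:
  fixes g :: "'i \<Rightarrow> 'a \<times> real \<Rightarrow> real"
  assumes g: "\<And>k. k \<in> I \<Longrightarrow> integrable (mu k) (g k)" "\<And>k. k \<in> I \<Longrightarrow> (\<integral>y. g k y \<partial>mu k) = 0"
    and ij: "i \<in> I" "j \<in> I" "i \<noteq> j"
  shows "(\<integral>z. g i (z i) * g j (z j) \<partial>sample) = 0"
proof -
  define h where "h k = (if k = i \<or> k = j then g k else (\<lambda>_. 1))" for k
  have ih: "integrable (mu k) (h k)" if "k \<in> I" for k using g(1)[OF that] by (auto simp: h_def)
  have "(\<Prod>k\<in>I. h k (z k)) = g i (z i) * g j (z j)" for z
  proof -
    have "(\<Prod>k\<in>I. h k (z k)) = (\<Prod>k\<in>{i, j}. h k (z k))"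
      using ij finite_I by (intro prod.mono_neutral_right) (auto simp: h_def)
    then show ?thesis using ij by (simp add: h_def)
  qed
  moreover have "(\<integral>z. (\<Prod>k\<in>I. h k (z k)) \<partial>sample) = (\<Prod>k\<in>I. \<integral>y. h k y \<partial>mu k)"
    by (intro product_integral_prod finite_I ih)
  moreover have "(\<Prod>k\<in>I. \<integral>y. h k y \<partial>mu k) = 0"
    using ij finite_I g(2) by (intro prod_zero) (auto simp: h_def)
  ultimately show ?thesis by simp
qed

text \<open>
  The variance of the sum is the sum of the variances, and each variance is at most the second
  moment, which is at most \<open>K\<close> times the mean for values in \<open>[0, K]\<close>.
\<close>

lemma variance_sum_le:
  fixes g :: "'i \<Rightarrow> 'a \<times> real \<Rightarrow> real"
  assumes gm: "\<And>k. k \<in> I \<Longrightarrow> g k \<in> borel_measurable (mu k)"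
    and gb: "\<And>k y. k \<in> I \<Longrightarrow> 0 \<le> g k y \<and> g k y \<le> K"
  shows "(\<integral>z. ((\<Sum>k\<in>I. \<integral>y. g k y \<partial>mu k) - (\<Sum>k\<in>I. g k (z k)))\<^sup>2 \<partial>sample) \<le> K * (\<Sum>k\<in>I. \<integral>y. g k y \<partial>mu k)"
proof -
  define m where "m k = (\<integral>y. g k y \<partial>mu k)" for k
  define h where "h k y = m k - g k y" for k y
  have ig: "integrable (mu k) (g k)" if "k \<in> I" for k
    using gm[OF that] gb[OF that] by (intro M.integrable_const_bound[where B = K]) auto
  have hm [measurable]: "h k \<in> borel_measurable (mu k)" if "k \<in> I" for k
    unfolding h_def using gm[OF that] by measurable
  have ih: "integrable (mu k) (h k)" "(\<integral>y. h k y \<partial>mu k) = 0" if "k \<in> I" for k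
    using ig[OF that] M.prob_space by (auto simp: h_def[abs_def] m_def)
  have m: "0 \<le> m k" "m k \<le> K" if "k \<in> I" for k
  proof -
    show "0 \<le> m k" using gb[OF that] by (simp add: m_def)
    have "m k \<le> (\<integral>y. K \<partial>mu k)" unfolding m_def using gb[OF that] ig[OF that] by (intro integral_mono) auto
    then show "m k \<le> K" using M.prob_space by simp
  qed
  have hb: "\<bar>h k y\<bar> \<le> K" if "k \<in> I" for k y
    using gb[OF that, of y] m[OF that] by (simp add: h_def abs_le_iff)
  have ipair: "integrable sample (\<lambda>z. h i (z i) * h j (z j))" if "i \<in> I" "j \<in> I" for i j
  proof (rule P.integrable_const_bound[where B = "K * K"])
    have "0 \<le> K" using gb[OF that(1)] order_trans by blast
    then have "\<bar>h i (z i) * h j (z j)\<bar> \<le> K * K" for z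
      unfolding abs_mult by (intro mult_mono hb that) auto
    then show "AE z in sample. norm (h i (z i) * h j (z j)) \<le> K * K" by simp
    show "(\<lambda>z. h i (z i) * h j (z j)) \<in> borel_measurable sample"
      using that hm[OF that(1)] hm[OF that(2)] by measurable
  qed
  have "((\<Sum>k\<in>I. m k) - (\<Sum>k\<in>I. g k (z k)))\<^sup>2 = (\<Sum>i\<in>I. \<Sum>j\<in>I. h i (z i) * h j (z j))" for z
    by (simp add: h_def power2_eq_square sum_subtractf[symmetric] sum_product)
  then have "(\<integral>z. ((\<Sum>k\<in>I. m k) - (\<Sum>k\<in>I. g k (z k)))\<^sup>2 \<partial>sample)
     = (\<Sum>i\<in>I. \<Sum>j\<in>I. \<integral>z. h i (z i) * h j (z j) \<partial>sample)"
    using ipair by simp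
  also have "\<dots> = (\<Sum>i\<in>I. \<integral>z. h i (z i) * h i (z i) \<partial>sample)"
  proof (rule sum.cong[OF refl])
    fix i assume i: "i \<in> I"
    have "(\<Sum>j\<in>I. \<integral>z. h i (z i) * h j (z j) \<partial>sample) = (\<Sum>j\<in>{i}. \<integral>z. h i (z i) * h j (z j) \<partial>sample)"
      using finite_I i by (intro sum.mono_neutral_right) (auto intro!: integral_pair_zero ih)
    then show "(\<Sum>j\<in>I. \<integral>z. h i (z i) * h j (z j) \<partial>sample) = (\<integral>z. h i (z i) * h i (z i) \<partial>sample)" by simp
  qed
  also have "\<dots> \<le> (\<Sum>i\<in>I. K * m i)"
  proof (rule sum_mono)
    fix i assume i: "i \<in> I"
    note [measurable] = hm[OF i] gm[OF i]
    have "(\<integral>z. h i (z i) * h i (z i) \<partial>sample) = (\<integral>y. h i y * h i y \<partial>mu i)"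
      by (rule integral_coordinate[OF i]) measurable
    also have "\<dots> \<le> (\<integral>y. K * g i y + (m i * m i - 2 * m i * g i y) \<partial>mu i)"
    proof (rule integral_mono)
      show "integrable (mu i) (\<lambda>y. h i y * h i y)"
      proof (rule M.integrable_const_bound[where B = "K * K"])
        have "0 \<le> K" using gb[OF i] order_trans by blast
        then have "\<bar>h i y * h i y\<bar> \<le> K * K" for y
          unfolding abs_mult by (intro mult_mono hb i) auto
        then show "AE y in mu i. norm (h i y * h i y) \<le> K * K" by simp
      qed measurable
      show "integrable (mu i) (\<lambda>y. K * g i y + (m i * m i - 2 * m i * g i y))"
        using ig[OF i] by simp
      show "h i y * h i y \<le> K * g i y + (m i * m i - 2 * m i * g i y)" for y
      proof -
        have "g i y * g i y \<le> K * g i y" using gb[OF i, of y] by (intro mult_right_mono) auto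
        then show ?thesis by (simp add: h_def algebra_simps)
      qed
    qed
    also have "\<dots> = K * m i - m i * m i"
      using ig[OF i] M.prob_space by (simp add: m_def)
    also have "\<dots> \<le> K * m i" by simp
    finally show "(\<integral>z. h i (z i) * h i (z i) \<partial>sample) \<le> K * m i" .
  qed
  finally show ?thesis by (simp add: m_def sum_distrib_left)
qed

definition mean_bias :: "('a \<Rightarrow> real) \<Rightarrow> real" where
  "mean_bias f = (\<Sum>k\<in>I. \<integral>z. sq_bias k (f (fst z)) (fst z) \<partial>mu k)"

lemma sq_bias_bounds: "0 \<le> sq_bias k v x" "\<bar>v\<bar> \<le> B \<Longrightarrow> sq_bias k v x \<le> 4 * B\<^sup>2"
proof -
  show "0 \<le> sq_bias k v x" by (simp add: sq_bias_def)
  assume "\<bar>v\<bar> \<le> B"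
  then have "\<bar>v - phi k x\<bar> \<le> \<bar>2 * B\<bar>" using abs_phi[of k x] B_pos by linarith
  then have "(v - phi k x)\<^sup>2 \<le> (2 * B)\<^sup>2" by (simp only: abs_le_square_iff)
  then show "sq_bias k v x \<le> 4 * B\<^sup>2" by (simp add: sq_bias_def power_mult_distrib)
qed

text \<open>
  The sum \<open>W\<close> of the ghost biases has mean \<open>D = mean_bias f\<close> and variance at most \<open>K D\<close> with
  \<open>K = 4 B\<^sup>2\<close>. The event fails only if \<open>D - W > t\<close> with \<open>t = (D (\<alpha> - 1) + n \<beta>) / \<alpha>\<close>. The assumption
  on \<open>\<beta>\<close> gives \<open>K D \<le> 8 t\<^sup>2\<close>, since \<open>D \<le> n K\<close>. Chebyshev's inequality would be useless for such
  a large variance; its one-sided form, Markov's inequality for \<open>(D - W + 8 t)\<^sup>2\<close>, bounds the failure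
  probability by \<open>(8 + 64) / 81 = 8/9\<close>.
\<close>

lemma ghost_lower_tail:
  assumes f: "f \<in> borel_measurable borel" "\<And>x. \<bar>f x\<bar> \<le> B"
    and beta: "0 < beta" "2 * B\<^sup>2 * weight\<^sup>2 \<le> real (card I) * (8 * (weight - 1) * beta + beta\<^sup>2 / B\<^sup>2)"
  shows "1 / 9 \<le> measure sample {z \<in> space sample.
    mean_bias f - real (card I) * beta \<le> weight * (\<Sum>k\<in>I. sq_bias k (f (fst (z k))) (fst (z k)))}"
proof -
  note [measurable] = f(1)
  define D where "D = mean_bias f"
  define n where "n = real (card I)"
  define K where "K = 4 * B\<^sup>2"
  define W :: "('i \<Rightarrow> 'a \<times> real) \<Rightarrow> real" where "W z = (\<Sum>k\<in>I. sq_bias k (f (fst (z k))) (fst (z k)))" for z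
  define t where "t = (D * (weight - 1) + n * beta) / weight"
  have n: "0 < n" using finite_I I_nonempty by (simp add: n_def card_gt_0_iff)
  have weight: "1 < weight" using lam_gt_1 by (simp add: weight_def)
  have K: "0 < K" using B_pos by (simp add: K_def)
  have Wm [measurable]: "W \<in> borel_measurable sample" unfolding W_def by measurable
  have W: "0 \<le> W z" "W z \<le> n * K" for z
    using sq_bias_bounds f(2) sum_bounded_above[of I "\<lambda>k. sq_bias k (f (fst (z k))) (fst (z k))" K]
    by (auto simp: W_def n_def K_def intro!: sum_nonneg)
  have D: "0 \<le> D" "D \<le> n * K"
  proof -
    show "0 \<le> D" unfolding D_def mean_bias_def by (intro sum_nonneg integral_nonneg_AE) (auto simp: sq_bias_bounds)
    have "(\<integral>z. sq_bias k (f (fst z)) (fst z) \<partial>mu k) \<le> K" for k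
    proof -
      have "(\<integral>z. sq_bias k (f (fst z)) (fst z) \<partial>mu k) \<le> (\<integral>z. K \<partial>mu k)"
        using sq_bias_bounds f(2)
        by (intro integral_mono M.integrable_const_bound[where B = K]) (auto simp: K_def)
      then show ?thesis using M.prob_space by simp
    qed
    then show "D \<le> n * K"
      unfolding D_def mean_bias_def n_def by (intro sum_bounded_above)
  qed
  have t0: "0 < t" using D n beta weight unfolding t_def by (intro divide_pos_pos add_nonneg_pos mult_nonneg_nonneg mult_pos_pos) auto
  have KD: "K * D \<le> 8 * t\<^sup>2"
  proof -
    \<comment> \<open>Multiplied by \<open>2 D\<close>, the two terms of the assumption become \<open>16 X Y\<close> and at most \<open>8 Y\<^sup>2\<close>\<close>
    define X Y where "X = D * (weight - 1)" and "Y = n * beta"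
    have "K * D * weight\<^sup>2 = D * 2 * (2 * B\<^sup>2 * weight\<^sup>2)" by (simp add: K_def)
    also have "\<dots> \<le> D * 2 * (n * (8 * (weight - 1) * beta + beta\<^sup>2 / B\<^sup>2))"
      using beta(2) D by (intro mult_left_mono) (auto simp: n_def)
    also have "\<dots> = 16 * X * Y + 8 * (D * (n * beta\<^sup>2 / K))"
      using B_pos by (simp add: K_def X_def Y_def field_simps)
    finally have 1: "K * D * weight\<^sup>2 \<le> 16 * X * Y + 8 * (D * (n * beta\<^sup>2 / K))" .
    have "D * (n * beta\<^sup>2 / K) \<le> (n * K) * (n * beta\<^sup>2 / K)"
      using D n K by (intro mult_right_mono) auto
    also have "\<dots> = Y\<^sup>2" using K by (simp add: Y_def power2_eq_square)
    finally have "K * D * weight\<^sup>2 \<le> 16 * X * Y + 8 * Y\<^sup>2" using 1 by linarith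
    also have "\<dots> \<le> 8 * (X + Y)\<^sup>2" by (simp add: power2_sum)
    finally have "K * D * weight\<^sup>2 \<le> 8 * (X + Y)\<^sup>2" .
    moreover have "X + Y = t * weight" using weight by (simp add: t_def X_def Y_def)
    ultimately have "K * D * weight\<^sup>2 \<le> 8 * t\<^sup>2 * weight\<^sup>2" by (simp add: power_mult_distrib)
    moreover have "0 < weight\<^sup>2" using weight by simp
    ultimately show ?thesis by (rule mult_right_le_imp_le)
  qed
  have expand: "((D - W z) + 8 * t)\<^sup>2 = (D - W z)\<^sup>2 + (16 * t) * (D - W z) + (8 * t)\<^sup>2" for z
    by (simp add: power2_eq_square algebra_simps)
  have iW: "integrable sample W"
    using W by (intro P.integrable_const_bound[where B = "n * K"]) auto
  have intW: "integrable sample (\<lambda>z. (D - W z))"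
    using iW by simp
  have intW2: "integrable sample (\<lambda>z. (D - W z)\<^sup>2)"
  proof (rule P.integrable_const_bound[where B = "(n * K)\<^sup>2"])
    have "\<bar>D - W z\<bar> \<le> \<bar>n * K\<bar>" for z using W[of z] D by linarith
    then show "AE z in sample. norm ((D - W z)\<^sup>2) \<le> (n * K)\<^sup>2" by (simp add: abs_le_square_iff)
  qed measurable
  have EW: "(\<integral>z. W z \<partial>sample) = D"
  proof -
    have "integrable sample (\<lambda>z. sq_bias k (f (fst (z k))) (fst (z k)))" if "k \<in> I" for k
      using that sq_bias_bounds f(2) by (intro P.integrable_const_bound[where B = K]) (auto simp: K_def)
    moreover have "(\<integral>z. sq_bias k (f (fst (z k))) (fst (z k)) \<partial>sample) = (\<integral>z. sq_bias k (f (fst z)) (fst z) \<partial>mu k)" if "k \<in> I" for k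
      by (rule integral_coordinate[OF that]) measurable
    ultimately show ?thesis unfolding W_def D_def mean_bias_def by simp
  qed
  have var: "(\<integral>z. (D - W z)\<^sup>2 \<partial>sample) \<le> K * D"
    unfolding D_def mean_bias_def W_def
    by (rule variance_sum_le[where g = "\<lambda>k z. sq_bias k (f (fst z)) (fst z)"]) (use sq_bias_bounds f(2) in \<open>auto simp: K_def\<close>)
  let ?bad = "{z \<in> space sample. weight * W z < D - n * beta}"
  have "81 * t\<^sup>2 * measure sample ?bad = (\<integral>z. 81 * t\<^sup>2 * indicator ?bad z \<partial>sample)"
    by simp
  also have "\<dots> \<le> (\<integral>z. ((D - W z) + 8 * t)\<^sup>2 \<partial>sample)"
  proof (rule integral_mono)
    show "integrable sample (\<lambda>z. 81 * t\<^sup>2 * indicator ?bad z :: real)"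
      by (intro integrable_mult_right P.integrable_const_bound[where B = 1]) auto
    show "integrable sample (\<lambda>z. ((D - W z) + 8 * t)\<^sup>2)"
      unfolding expand using intW intW2 by (intro Bochner_Integration.integrable_add) auto
    fix z
    show "81 * t\<^sup>2 * indicator ?bad z \<le> ((D - W z) + 8 * t)\<^sup>2"
    proof (cases "z \<in> ?bad")
      case True
      then have "W z < (D - n * beta) / weight" using weight by (simp add: field_simps)
      also have "\<dots> = D - t" using weight by (simp add: t_def field_simps)
      finally have "9 * t \<le> (D - W z) + 8 * t" by simp
      then have "(9 * t)\<^sup>2 \<le> ((D - W z) + 8 * t)\<^sup>2" using t0 by (intro power_mono) auto
      then show ?thesis using True by (simp add: power_mult_distrib)
    qed simp
  qed
  also have "\<dots> = (\<integral>z. (D - W z)\<^sup>2 \<partial>sample) + (8 * t)\<^sup>2"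
  proof -
    have "(\<integral>z. (D - W z) \<partial>sample) = 0"
      using EW iW by (simp add: P.prob_space)
    then show ?thesis
      unfolding expand using intW intW2 by (simp add: P.prob_space)
  qed
  also have "\<dots> \<le> 72 * t\<^sup>2" using var KD by (simp add: power_mult_distrib)
  finally have "measure sample ?bad \<le> 72 / 81" using t0 by (simp add: field_simps)
  moreover have "measure sample {z \<in> space sample. D - n * beta \<le> weight * W z} = 1 - measure sample ?bad"
    by (subst P.prob_compl[symmetric]) (auto intro!: arg_cong[where f = "measure sample"])
  ultimately show ?thesis by (simp add: D_def n_def W_def)
qed


section \<open>Symmetrization\<close>

definition emp_bias :: "('a \<Rightarrow> real) \<Rightarrow> ('i \<Rightarrow> 'a \<times> real) \<Rightarrow> real" where
  "emp_bias f z = (\<Sum>k\<in>I. sq_bias k (f (fst (z k))) (fst (z k)))"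

definition emp_excess :: "('a \<Rightarrow> real) \<Rightarrow> ('i \<Rightarrow> 'a \<times> real) \<Rightarrow> real" where
  "emp_excess f z = (\<Sum>k\<in>I. excess_at k (f (fst (z k))) (z k))"

lemma emp_measurable [measurable]:
  assumes [measurable]: "f \<in> borel_measurable borel"
  shows "emp_bias f \<in> borel_measurable sample" "emp_excess f \<in> borel_measurable sample"
  unfolding emp_bias_def emp_excess_def by measurable

definition swap_coords :: "'i set \<Rightarrow> ('i \<Rightarrow> 'a \<times> real) \<times> ('i \<Rightarrow> 'a \<times> real) \<Rightarrow> ('i \<Rightarrow> 'a \<times> real) \<times> ('i \<Rightarrow> 'a \<times> real)" where
  "swap_coords J p = (\<lambda>k\<in>I. if k \<in> J then snd p k else fst p k, \<lambda>k\<in>I. if k \<in> J then fst p k else snd p k)"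

lemma swap_coords_measurable [measurable]: "swap_coords J \<in> measurable (sample \<Otimes>\<^sub>M sample) (sample \<Otimes>\<^sub>M sample)"
proof -
  have "(\<lambda>p. \<lambda>k\<in>I. if k \<in> J then snd p k else fst p k) \<in> measurable (sample \<Otimes>\<^sub>M sample) sample"
    by (intro measurable_restrict) (auto intro!: measurable_compose[OF measurable_snd measurable_component_singleton] measurable_compose[OF measurable_fst measurable_component_singleton])
  moreover have "(\<lambda>p. \<lambda>k\<in>I. if k \<in> J then fst p k else snd p k) \<in> measurable (sample \<Otimes>\<^sub>M sample) sample"
    by (intro measurable_restrict) (auto intro!: measurable_compose[OF measurable_snd measurable_component_singleton] measurable_compose[OF measurable_fst measurable_component_singleton])
  ultimately show ?thesis unfolding swap_coords_def by (rule measurable_Pair)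
qed

text \<open>
  Both samples together are one family indexed by \<open>I \<times> bool\<close>, and the swap permutes the indices
  within each pair, where the two laws agree.
\<close>

lemma distr_swap_coords: "distr (sample \<Otimes>\<^sub>M sample) (sample \<Otimes>\<^sub>M sample) (swap_coords J) = sample \<Otimes>\<^sub>M sample"
proof -
  let ?S = "sample \<Otimes>\<^sub>M sample"
  \<comment> \<open>\<open>N\<close> is the family for both samples, \<open>p b\<close> extracts the sample with label \<open>b\<close>, and \<open>flip\<close> permutes the indices\<close>
  define N :: "'i \<times> bool \<Rightarrow> ('a \<times> real) measure" where "N i = mu (fst i)" for i
  define K where "K = I \<times> (UNIV :: bool set)"
  define p where "p b \<omega> = (\<lambda>k\<in>I. \<omega> (k, b))" for b and \<omega> :: "'i \<times> bool \<Rightarrow> 'a \<times> real"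
  define flip where "flip i = (fst i, if fst i \<in> J then \<not> snd i else snd i)" for i :: "'i \<times> bool"
  define r where "r \<omega> = (\<lambda>i\<in>K. \<omega> (flip i))" for \<omega> :: "'i \<times> bool \<Rightarrow> 'a \<times> real"
  interpret N: product_prob_space N K
    by (intro product_prob_spaceI) (simp add: N_def prob_mu)
  have half: "distr (PiM (I \<times> {b}) N) sample (p b) = sample" for b
    using distr_PiM_reindex[of "I \<times> {b}" N "\<lambda>k. (k, b)" I]
    by (auto simp: N_def p_def[abs_def] prob_mu inj_on_def)
  have pm: "p b \<in> measurable (PiM A N) sample" if "I \<times> {b} \<subseteq> A" for b A
    unfolding p_def using that measurable_component_singleton[of _ A N]
    by (intro measurable_restrict) (auto simp: N_def)
  have pair_meas [measurable]: "(\<lambda>\<omega>. (p False \<omega>, p True \<omega>)) \<in> measurable (PiM K N) ?S"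
    by (intro measurable_Pair pm) (auto simp: K_def)
  have Kun: "I \<times> {False} \<union> I \<times> {True} = K" by (auto simp: K_def)
  have both: "distr (PiM K N) ?S (\<lambda>\<omega>. (p False \<omega>, p True \<omega>)) = ?S"
  proof -
    let ?M = "PiM (I \<times> {False}) N \<Otimes>\<^sub>M PiM (I \<times> {True}) N"
    have mm: "merge (I \<times> {False}) (I \<times> {True}) \<in> measurable ?M (PiM K N)"
      using measurable_merge[of "I \<times> {False}" "I \<times> {True}" N] unfolding Kun .
    have K_eq: "PiM K N = distr ?M (PiM K N) (merge (I \<times> {False}) (I \<times> {True}))"
      by (rule N.distr_merge[of "I \<times> {False}" "I \<times> {True}", unfolded Kun, symmetric]) (use finite_I in auto)
    have "distr (PiM K N) ?S (\<lambda>\<omega>. (p False \<omega>, p True \<omega>))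
        = distr ?M ?S ((\<lambda>\<omega>. (p False \<omega>, p True \<omega>)) \<circ> merge (I \<times> {False}) (I \<times> {True}))"
      by (subst K_eq) (rule distr_distr[OF pair_meas mm])
    also have "(\<lambda>\<omega>. (p False \<omega>, p True \<omega>)) \<circ> merge (I \<times> {False}) (I \<times> {True}) = (\<lambda>(x, y). (p False x, p True y))"
      by (auto simp: fun_eq_iff p_def merge_def)
    also have "distr ?M ?S (\<lambda>(x, y). (p False x, p True y))
        = distr (PiM (I \<times> {False}) N) sample (p False) \<Otimes>\<^sub>M distr (PiM (I \<times> {True}) N) sample (p True)"
      by (rule pair_measure_distr[symmetric]) (auto simp: half intro!: pm P.sigma_finite_measure_axioms)
    finally show ?thesis by (simp add: half)
  qed
  have r_meas: "r \<in> measurable (PiM K N) (PiM K N)"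
    unfolding r_def using measurable_component_singleton[of _ K N]
    by (intro measurable_restrict) (auto simp: N_def flip_def K_def)
  have flip_law: "distr (PiM K N) (PiM K N) r = PiM K N"
  proof -
    have inj: "inj_on flip K" by (auto simp: inj_on_def flip_def split: if_splits)
    have map: "flip \<in> K \<rightarrow> K" by (auto simp: flip_def K_def)
    have law: "N (flip i) = N i" for i by (simp add: N_def flip_def)
    show ?thesis
      using distr_PiM_reindex[of K N flip K, OF _ inj map] unfolding law r_def[abs_def]
      by (simp add: N_def[abs_def] prob_mu)
  qed
  have comm: "swap_coords J (p False \<omega>, p True \<omega>) = (p False (r \<omega>), p True (r \<omega>))" for \<omega>
    by (auto simp: swap_coords_def p_def r_def flip_def K_def fun_eq_iff)
  have "distr ?S ?S (swap_coords J) = distr (distr (PiM K N) ?S (\<lambda>\<omega>. (p False \<omega>, p True \<omega>))) ?S (swap_coords J)"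
    by (simp add: both)
  also have "\<dots> = distr (PiM K N) ?S (swap_coords J \<circ> (\<lambda>\<omega>. (p False \<omega>, p True \<omega>)))"
    by (rule distr_distr) measurable
  also have "swap_coords J \<circ> (\<lambda>\<omega>. (p False \<omega>, p True \<omega>)) = (\<lambda>\<omega>. (p False \<omega>, p True \<omega>)) \<circ> r"
    by (simp add: fun_eq_iff comm)
  also have "distr (PiM K N) ?S \<dots> = distr (distr (PiM K N) (PiM K N) r) ?S (\<lambda>\<omega>. (p False \<omega>, p True \<omega>))"
    by (rule distr_distr[OF pair_meas r_meas, symmetric])
  also have "\<dots> = ?S" by (simp add: flip_law both)
  finally show ?thesis .
qed

lemma pred_exists_measurable:
  assumes "countable F" "\<And>f. f \<in> F \<Longrightarrow> g f \<in> borel_measurable M"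
  shows "{x \<in> space M. \<exists>f\<in>F. (t::real) < g f x} \<in> sets M"
  using assms by (intro predE pred_intros_countable_bounded) (auto intro: borel_measurable_pred_less)

text \<open>
  After the swap, the statistic is \<open>mixed_deviation J\<close> of the first sample plus
  \<open>mixed_deviation (I - J)\<close> of the second, and one of the two exceeds half of the threshold. Summing
  over all \<open>J\<close> makes both contributions equal, by passing to complements.
\<close>

lemma swap_bound:
  assumes F: "countable F" "F \<subseteq> borel_measurable borel"
  shows "2 ^ card I * emeasure (sample \<Otimes>\<^sub>M sample)
      {p \<in> space (sample \<Otimes>\<^sub>M sample). \<exists>f\<in>F. 2 * t < weight * emp_bias f (snd p) - lam * emp_excess f (fst p)}
    \<le> 2 * (\<Sum>J\<in>Pow I. emeasure sample {z \<in> space sample. \<exists>f\<in>F. t < mixed_deviation J (\<lambda>k. f (fst (z k))) z})"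
    (is "_ * emeasure ?S ?E \<le> 2 * (\<Sum>J\<in>_. emeasure sample (?A J))")
proof -
  interpret S: pair_prob_space sample sample ..
  have fm [measurable]: "f \<in> borel_measurable borel" if "f \<in> F" for f using F that by auto
  have E [measurable]: "?E \<in> sets ?S"
    by (intro pred_exists_measurable F(1)) measurable
  have A [measurable]: "?A J \<in> sets sample" if "J \<subseteq> I" for J
    using that by (intro pred_exists_measurable mixed_deviation_measurable F(1)) measurable
  have bound: "emeasure ?S ?E \<le> emeasure sample (?A J) + emeasure sample (?A (I - J))" if J: "J \<subseteq> I" for J
  proof -
    have "emeasure ?S ?E = emeasure (distr ?S ?S (swap_coords J)) ?E" by (simp only: distr_swap_coords)
    also have "\<dots> = emeasure ?S (swap_coords J -` ?E \<inter> space ?S)"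
      by (rule emeasure_distr) measurable
    also have "\<dots> \<le> emeasure ?S ((?A J \<times> space sample) \<union> (space sample \<times> ?A (I - J)))"
    proof (rule emeasure_mono)
      show "swap_coords J -` ?E \<inter> space ?S \<subseteq> (?A J \<times> space sample) \<union> (space sample \<times> ?A (I - J))"
      proof
        fix p assume p: "p \<in> swap_coords J -` ?E \<inter> space ?S"
        obtain z z' where zz: "p = (z, z')" by (cases p)
        from p obtain f where f: "f \<in> F" "2 * t < weight * emp_bias f (snd (swap_coords J p)) - lam * emp_excess f (fst (swap_coords J p))"
          by auto
        have g: "weight * emp_bias f (snd (swap_coords J p)) = (\<Sum>k\<in>J. weight * sq_bias k (f (fst (z k))) (fst (z k))) + (\<Sum>k\<in>I - J. weight * sq_bias k (f (fst (z' k))) (fst (z' k)))"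
        proof -
          have "weight * emp_bias f (snd (swap_coords J p)) = (\<Sum>k\<in>I. if k \<in> J then weight * sq_bias k (f (fst (z k))) (fst (z k)) else weight * sq_bias k (f (fst (z' k))) (fst (z' k)))"
            unfolding emp_bias_def sum_distrib_left by (intro sum.cong) (auto simp: zz swap_coords_def)
          then show ?thesis using finite_I J by (simp add: sum.If_cases Int_absorb1 Diff_eq)
        qed
        have e: "lam * emp_excess f (fst (swap_coords J p)) = (\<Sum>k\<in>J. lam * excess_at k (f (fst (z' k))) (z' k)) + (\<Sum>k\<in>I - J. lam * excess_at k (f (fst (z k))) (z k))"
        proof -
          have "lam * emp_excess f (fst (swap_coords J p)) = (\<Sum>k\<in>I. if k \<in> J then lam * excess_at k (f (fst (z' k))) (z' k) else lam * excess_at k (f (fst (z k))) (z k))"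
            unfolding emp_excess_def sum_distrib_left by (intro sum.cong) (auto simp: zz swap_coords_def)
          then show ?thesis using finite_I J by (simp add: sum.If_cases Int_absorb1 Diff_eq)
        qed
        have "weight * emp_bias f (snd (swap_coords J p)) - lam * emp_excess f (fst (swap_coords J p))
          = mixed_deviation J (\<lambda>k. f (fst (z k))) z + mixed_deviation (I - J) (\<lambda>k. f (fst (z' k))) z'"
          unfolding g e mixed_deviation_def using J by (simp add: double_diff)
        then have "t < mixed_deviation J (\<lambda>k. f (fst (z k))) z \<or> t < mixed_deviation (I - J) (\<lambda>k. f (fst (z' k))) z'"
          using f(2) by linarith
        then show "p \<in> (?A J \<times> space sample) \<union> (space sample \<times> ?A (I - J))"
          using p f(1) by (auto simp: zz space_pair_measure)
      qed
    qed (use J in measurable)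
    also have "\<dots> \<le> emeasure ?S (?A J \<times> space sample) + emeasure ?S (space sample \<times> ?A (I - J))"
      using J by (intro emeasure_subadditive) measurable
    also have "\<dots> = emeasure sample (?A J) + emeasure sample (?A (I - J))"
      using J by (simp add: P.emeasure_pair_measure_Times A P.emeasure_space_1)
    finally show ?thesis .
  qed
  have "2 ^ card I * emeasure ?S ?E = (\<Sum>J\<in>Pow I. emeasure ?S ?E)"
    using finite_I by (simp add: card_Pow)
  also have "\<dots> \<le> (\<Sum>J\<in>Pow I. emeasure sample (?A J) + emeasure sample (?A (I - J)))"
    by (intro sum_mono bound) auto
  also have "\<dots> = (\<Sum>J\<in>Pow I. emeasure sample (?A J)) + (\<Sum>J\<in>Pow I. emeasure sample (?A (I - J)))"
    by (rule sum.distrib)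
  also have "(\<Sum>J\<in>Pow I. emeasure sample (?A (I - J))) = (\<Sum>J\<in>Pow I. emeasure sample (?A J))"
    by (rule sum.reindex_bij_witness[where i = "\<lambda>J. I - J" and j = "\<lambda>J. I - J"]) (auto simp: double_diff)
  finally show ?thesis unfolding mult_2[where 'a = ennreal] .
qed

text \<open>
  The violating function depends on the first sample; it is taken to be the first one in an
  enumeration of \<open>F\<close>. For each candidate, being chosen and having a good ghost sample are conditions
  on different samples, so that the joint event is a rectangle, whose second side has probability at
  least \<open>1/9\<close>.
\<close>

lemma ghost_symmetrization:
  assumes F: "countable F" "F \<subseteq> borel_measurable borel" "\<And>f x. f \<in> F \<Longrightarrow> \<bar>f x\<bar> \<le> B"
    and beta: "0 < beta" "2 * B\<^sup>2 * weight\<^sup>2 \<le> real (card I) * (8 * (weight - 1) * beta + beta\<^sup>2 / B\<^sup>2)"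
  shows "emeasure sample {z \<in> space sample. \<exists>f\<in>F. real (card I) * eps < mean_bias f - lam * emp_excess f z}
    \<le> 9 * emeasure (sample \<Otimes>\<^sub>M sample) {p \<in> space (sample \<Otimes>\<^sub>M sample).
        \<exists>f\<in>F. real (card I) * (eps - beta) < weight * emp_bias f (snd p) - lam * emp_excess f (fst p)}"
    (is "emeasure _ ?L \<le> 9 * emeasure ?S ?E")
proof (cases "F = {}")
  case False
  interpret S: pair_prob_space sample sample ..
  have fm [measurable]: "f \<in> borel_measurable borel" if "f \<in> F" for f using F that by auto
  define g where "g = from_nat_into F"
  have range_g: "range g = F" using False F(1) by (simp add: g_def range_from_nat_into)
  then have gF: "g i \<in> F" for i by auto
  note [measurable] = fm[OF gF]
  define A where "A i = {z \<in> space sample. real (card I) * eps < mean_bias (g i) - lam * emp_excess (g i) z}" for i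
  define D where "D i = {z \<in> space sample. mean_bias (g i) - real (card I) * beta \<le> weight * emp_bias (g i) z}" for i
  have Am: "A i \<in> sets sample" for i unfolding A_def by measurable
  have Dm: "D i \<in> sets sample" for i unfolding D_def by measurable
  have dA: "disjointed A i \<in> sets sample" for i
    using sets.range_disjointed_sets[of A sample] Am by auto
  have E: "?E \<in> sets ?S"
    by (intro pred_exists_measurable F(1)) measurable
  have one: "1 \<le> 9 * emeasure sample (D i)" for i
  proof -
    have "1 / 9 \<le> measure sample (D i)"
      unfolding D_def emp_bias_def using F gF beta by (intro ghost_lower_tail) auto
    then have "ennreal 1 \<le> ennreal (9 * measure sample (D i))" by (intro ennreal_leI) simp
    then show ?thesis by (simp add: ennreal_mult P.emeasure_eq_measure)
  qed
  have "?L = (\<Union>i. A i)" unfolding range_g[symmetric] A_def by auto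
  then have "emeasure sample ?L = emeasure sample (\<Union>i. disjointed A i)"
    by (simp add: UN_disjointed_eq)
  also have "\<dots> = (\<Sum>i. emeasure sample (disjointed A i))"
    using dA by (intro suminf_emeasure[symmetric]) (auto simp: disjoint_family_disjointed)
  also have "\<dots> \<le> (\<Sum>i. 9 * emeasure ?S (disjointed A i \<times> D i))"
  proof (intro suminf_le)
    fix i
    have "emeasure sample (disjointed A i) * 1 \<le> emeasure sample (disjointed A i) * (9 * emeasure sample (D i))"
      by (intro mult_left_mono one) auto
    then show "emeasure sample (disjointed A i) \<le> 9 * emeasure ?S (disjointed A i \<times> D i)"
      using dA Dm by (simp add: P.emeasure_pair_measure_Times ac_simps)
  qed auto
  also have "\<dots> = 9 * (\<Sum>i. emeasure ?S (disjointed A i \<times> D i))"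
    by (rule ennreal_suminf_cmult)
  also have "(\<Sum>i. emeasure ?S (disjointed A i \<times> D i)) = emeasure ?S (\<Union>i. disjointed A i \<times> D i)"
    using dA Dm disjoint_family_disjointed[of A]
    by (intro suminf_emeasure) (auto simp: disjoint_family_on_def, blast)
  also have "\<dots> \<le> emeasure ?S ?E"
  proof (rule emeasure_mono[OF _ E], safe)
    fix z z' i assume z: "z \<in> disjointed A i" "z' \<in> D i"
    then have "z \<in> A i" using disjointed_subset[of A i] by auto
    then have "real (card I) * (eps - beta) < weight * emp_bias (g i) z' - lam * emp_excess (g i) z"
      using z(2) by (simp add: A_def D_def right_diff_distrib)
    then show "\<exists>f\<in>F. real (card I) * (eps - beta) < weight * emp_bias f (snd (z, z')) - lam * emp_excess f (fst (z, z'))"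
      using gF by auto
    show "(z, z') \<in> space ?S"
      using \<open>z \<in> A i\<close> z(2) by (auto simp: A_def D_def space_pair_measure)
  qed
  finally show ?thesis by (simp add: mult_left_mono)
qed simp

end

section \<open>Measurable choice of a cover\<close>

lemma finite_grid:
  assumes "0 < r"
  obtains Q where "finite Q" "Q \<subseteq> {- B..B::real}" "\<And>y. y \<in> {- B..B} \<Longrightarrow> \<exists>q\<in>Q. \<bar>q - y\<bar> \<le> r"
proof -
  have "seq_compact {- B..B}" using compact_imp_seq_compact by blast
  then obtain Q where "finite Q" "Q \<subseteq> {- B..B}" "{- B..B} \<subseteq> (\<Union>q\<in>Q. ball q r)"
    using seq_compact_imp_totally_bounded[of "{- B..B}"] assms by meson
  moreover have "\<exists>q\<in>Q. \<bar>q - y\<bar> \<le> r" if "y \<in> {- B..B}" for y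
  proof -
    have "y \<in> (\<Union>q\<in>Q. ball q r)" using calculation(3) that by (rule subsetD)
    then obtain q where "q \<in> Q" "dist q y < r" by auto
    then show ?thesis by (intro bexI[of _ q]) (auto simp: dist_real_def)
  qed
  ultimately show ?thesis using that by blast
qed

text \<open>
  Centres are rounded to a finite grid of mesh \<open>r\<close> in \<open>[-B, B]\<close>, which turns a cover of radius \<open>r\<close>
  into one of radius \<open>2 r\<close> with at most as many centres. Then only finitely many candidate covers
  remain. A candidate of minimal size among those that cover at \<open>x\<close> depends on \<open>x\<close> only through the
  set of candidates that do cover, and this set is measurable in \<open>x\<close> because \<open>F\<close> is countable. The
  covering number may refer to any larger family \<open>F'\<close>, countable or not.
\<close>

lemma measurable_cover_selection:
  fixes F F' :: "('a::topological_space \<Rightarrow> real) set"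
  assumes n: "1 \<le> n" and B: "0 \<le> B" and r: "0 < r"
    and F: "countable F" "F \<subseteq> borel_measurable borel" "\<And>f x. f \<in> F \<Longrightarrow> \<bar>f x\<bar> \<le> B"
    and FF': "F \<subseteq> F'"
  obtains V sel where "finite V" "\<And>l k. l \<in> V \<Longrightarrow> k \<in> {1..n} \<Longrightarrow> \<bar>l k\<bar> \<le> B"
    "\<And>l. l \<in> V \<Longrightarrow> {x \<in> space (PiM {1..n} (\<lambda>_. borel)). l \<in> sel x} \<in> sets (PiM {1..n} (\<lambda>_. borel :: 'a measure))"
    "\<And>x. sel x \<subseteq> V"
    "\<And>x f. f \<in> F \<Longrightarrow> \<exists>l\<in>sel x. (\<Sum>k=1..n. \<bar>l k - f (x k)\<bar>) \<le> real n * (2 * r)"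
    "(\<lambda>x. of_nat (card (sel x)) :: ennreal) \<in> borel_measurable (PiM {1..n} (\<lambda>_. borel))"
    "\<And>x. of_nat (card (sel x)) \<le> ennreal_of_enat (covering_number n F' x r)"
proof -
  obtain Q where Q: "finite Q" "Q \<subseteq> {- B..B}" "\<And>y. y \<in> {- B..B} \<Longrightarrow> \<exists>q\<in>Q. \<bar>q - y\<bar> \<le> r"
    using finite_grid[OF r] by blast
  define V where "V = PiE {1..n} (\<lambda>_. Q)"
  define cov where "cov C x \<longleftrightarrow> (\<forall>f\<in>F. \<exists>l\<in>C. (\<Sum>k=1..n. \<bar>l k - f (x k)\<bar>) \<le> real n * (2 * r))"
    for C :: "(nat \<Rightarrow> real) set" and x :: "nat \<Rightarrow> 'a"
  define covers where "covers x = {C \<in> Pow V. cov C x}" for x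
  define sel where "sel x = arg_min card (\<lambda>C. C \<in> covers x)" for x
  have V: "finite V" unfolding V_def using Q(1) by (intro finite_PiE) auto
  obtain nearest where nearest: "\<And>y. nearest (trunc B y) \<in> Q" "\<And>y. \<bar>nearest (trunc B y) - trunc B y\<bar> \<le> r"
  proof -
    have "\<exists>q. q \<in> Q \<and> \<bar>q - trunc B y\<bar> \<le> r" for y
      using Q(3)[of "trunc B y"] trunc_bounds[OF B, of y] by auto
    then have "(SOME q. q \<in> Q \<and> \<bar>q - trunc B y\<bar> \<le> r) \<in> Q \<and> \<bar>(SOME q. q \<in> Q \<and> \<bar>q - trunc B y\<bar> \<le> r) - trunc B y\<bar> \<le> r" for y
      by (rule someI_ex)
    then show ?thesis using that[of "\<lambda>y. SOME q. q \<in> Q \<and> \<bar>q - y\<bar> \<le> r"] by blast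
  qed
  \<comment> \<open>Centres are truncated before rounding, which moves them no farther from functions with values in \<open>[-B, B]\<close>\<close>
  define rnd where "rnd l = (\<lambda>k\<in>{1..n}. nearest (trunc B (l k)))" for l :: "nat \<Rightarrow> real"
  have rndV: "rnd l \<in> V" for l using nearest(1) by (simp add: rnd_def V_def)
  have rnd_close: "(\<Sum>k=1..n. \<bar>rnd l k - f (x k)\<bar>) \<le> real n * (2 * r)"
    if f: "f \<in> F" and l: "(\<Sum>k=1..n. \<bar>l k - f (x k)\<bar>) \<le> real n * r" for l f x
  proof -
    have "\<bar>rnd l k - f (x k)\<bar> \<le> r + \<bar>l k - f (x k)\<bar>" if "k \<in> {1..n}" for k
    proof -
      have "trunc B (f (x k)) = f (x k)" using F(3)[OF f, of "x k"] by (intro trunc_id) auto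
      then show ?thesis
        using nearest(2)[of "l k"] trunc_nonexpansive[of B "l k" "f (x k)"] that by (simp add: rnd_def)
    qed
    then have "(\<Sum>k=1..n. \<bar>rnd l k - f (x k)\<bar>) \<le> (\<Sum>k=1..n. r + \<bar>l k - f (x k)\<bar>)" by (rule sum_mono)
    also have "\<dots> \<le> real n * (2 * r)" using l by (simp add: sum.distrib algebra_simps)
    finally show ?thesis .
  qed
  have small: "rnd ` C \<in> covers x" if C: "\<forall>f\<in>F. \<exists>l\<in>C. (\<Sum>k=1..n. \<bar>l k - f (x k)\<bar>) \<le> real n * r" for C x
    unfolding covers_def cov_def using rndV rnd_close C by fastforce
  have Vcov: "V \<in> covers x" for x
  proof -
    have "rnd ` UNIV \<in> covers x"
    proof (rule small, rule ballI)
      fix f assume "f \<in> F"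
      then show "\<exists>l\<in>UNIV. (\<Sum>k=1..n. \<bar>l k - f (x k)\<bar>) \<le> real n * r"
        using r by (intro bexI[of _ "\<lambda>k. f (x k)"]) auto
    qed
    then have "cov V x" using rndV unfolding covers_def cov_def by fastforce
    then show ?thesis by (simp add: covers_def)
  qed
  have sel: "sel x \<in> covers x" "\<And>C. C \<in> covers x \<Longrightarrow> card (sel x) \<le> card C" for x
    using arg_min_nat_lemma[of "\<lambda>C. C \<in> covers x", OF Vcov, of card] unfolding sel_def by blast+
  have selV: "sel x \<subseteq> V" for x using sel(1)[of x] by (auto simp: covers_def)
  have sel_meas: "{x \<in> space (PiM {1..n} (\<lambda>_. borel)). l \<in> sel x} \<in> sets (PiM {1..n} (\<lambda>_. borel :: 'a measure))"
    if "l \<in> V" for l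
  proof -
    let ?M = "PiM {1..n} (\<lambda>_. borel :: 'a measure)"
    have cov_meas [measurable]: "Measurable.pred ?M (cov C)" if "C \<in> Pow V" for C
    proof -
      have "finite C" using that V finite_subset by auto
      have fM: "Measurable.pred ?M (\<lambda>x. (\<Sum>k=1..n. \<bar>l k - f (x k)\<bar>) \<le> real n * (2 * r))" if "f \<in> F" for f and l :: "nat \<Rightarrow> real"
      proof -
        have [measurable]: "f \<in> borel_measurable borel" using F(2) that by auto
        show ?thesis by measurable
      qed
      show ?thesis
        unfolding cov_def[abs_def]
        by (intro measurable_pred_countable F(1) countable_finite[OF \<open>finite C\<close>] fM)
    qed
    \<comment> \<open>The possible sets of covering candidates for which the minimal one contains \<open>l\<close>\<close>
    define Ps where "Ps = {P \<in> Pow (Pow V). l \<in> arg_min card (\<lambda>C. C \<in> P)}"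
    have "finite Ps" using V by (simp add: Ps_def)
    have "{x \<in> space ?M. l \<in> sel x} = (\<Union>P\<in>Ps. {x \<in> space ?M. \<forall>C\<in>Pow V. cov C x \<longleftrightarrow> C \<in> P})"
    proof (safe)
      fix x assume "x \<in> space ?M" "l \<in> sel x"
      then show "x \<in> (\<Union>P\<in>Ps. {x \<in> space ?M. \<forall>C\<in>Pow V. cov C x \<longleftrightarrow> C \<in> P})"
        by (intro UN_I[of "covers x"]) (auto simp: Ps_def covers_def sel_def)
    next
      fix x P assume P: "P \<in> Ps" "\<forall>C\<in>Pow V. cov C x \<longleftrightarrow> C \<in> P"
      then have "P = covers x" by (auto simp: Ps_def covers_def)
      then show "l \<in> sel x" using P(1) by (simp add: Ps_def sel_def)
    qed
    also have "\<dots> \<in> sets ?M"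
    proof -
      have eqm: "Measurable.pred ?M (\<lambda>x. cov C x \<longleftrightarrow> C \<in> P)" if "C \<in> Pow V" for C P
        using cov_meas[OF that] by measurable
      show ?thesis
        by (intro sets.finite_UN \<open>finite Ps\<close> predE pred_intros_finite eqm) (use V in auto)
    qed
    finally show ?thesis .
  qed
  show ?thesis
  proof (rule that[of V sel, OF V _ sel_meas selV])
    show "\<bar>l k\<bar> \<le> B" if "l \<in> V" "k \<in> {1..n}" for l k
    proof -
      have "l k \<in> Q" using that by (auto simp: V_def PiE_iff)
      from subsetD[OF Q(2) this] show ?thesis by auto
    qed
    show "\<exists>l\<in>sel x. (\<Sum>k=1..n. \<bar>l k - f (x k)\<bar>) \<le> real n * (2 * r)" if "f \<in> F" for x f
      using sel(1)[of x] that by (auto simp: covers_def cov_def)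
    show "of_nat (card (sel x)) \<le> ennreal_of_enat (covering_number n F' x r)" for x
    proof -
      have "enat (card (sel x)) \<le> covering_number n F' x r"
        unfolding covering_number_def
      proof (rule Inf_greatest)
        fix m assume "m \<in> {enat (card L0) |L0. finite L0 \<and> L0 \<subseteq> (\<Pi>\<^sub>E k\<in>{1..n}. borel_measurable borel) \<and>
          (\<forall>f\<in>F'. \<exists>l\<in>L0. 1 / real n * (\<Sum>k=1..n. \<bar>l k (x k) - f (x k)\<bar>) \<le> r)}"
        then obtain L0 where L0: "m = enat (card L0)" "finite L0"
          "\<forall>f\<in>F'. \<exists>l\<in>L0. 1 / real n * (\<Sum>k=1..n. \<bar>l k (x k) - f (x k)\<bar>) \<le> r" by blast
        define C where "C = (\<lambda>l k. l k (x k)) ` L0"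
        have "\<exists>l\<in>C. (\<Sum>k=1..n. \<bar>l k - f (x k)\<bar>) \<le> real n * r" if "f \<in> F" for f
        proof -
          have "f \<in> F'" using that FF' by blast
          from L0(3)[rule_format, OF this] obtain l
            where l: "l \<in> L0" "1 / real n * (\<Sum>k=1..n. \<bar>l k (x k) - f (x k)\<bar>) \<le> r" by (elim bexE)
          have "(\<Sum>k=1..n. \<bar>l k (x k) - f (x k)\<bar>) \<le> real n * r"
            using mult_left_mono[OF l(2), of "real n"] n by simp
          then show ?thesis unfolding C_def using l(1) by (intro bexI[of _ "\<lambda>k. l k (x k)"] imageI) simp_all
        qed
        then have "card (sel x) \<le> card (rnd ` C)" by (intro sel(2) small ballI)
        also have "\<dots> \<le> card L0" unfolding C_def image_image by (rule card_image_le[OF L0(2)])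
        finally show "enat (card (sel x)) \<le> m" by (simp add: L0(1))
      qed
      then have "ennreal_of_enat (enat (card (sel x))) \<le> ennreal_of_enat (covering_number n F' x r)"
        by (simp only: ennreal_of_enat_le_iff)
      then show ?thesis by simp
    qed
    show "(\<lambda>x. of_nat (card (sel x)) :: ennreal) \<in> borel_measurable (PiM {1..n} (\<lambda>_. borel))"
    proof -
      have "of_nat (card (sel x)) = (\<Sum>l\<in>V. indicator {x \<in> space (PiM {1..n} (\<lambda>_. borel)). l \<in> sel x} x :: ennreal)"
        if "x \<in> space (PiM {1..n} (\<lambda>_. borel))" for x
        using V selV[of x] that by (simp add: indicator_def sum.If_cases Int_absorb1)
      then show ?thesis using sel_meas by (subst measurable_cong) auto
    qed
  qed
qed

section \<open>The uniform deviation inequality and its constants\<close>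

context truncated_regression begin

text \<open>
  The constant \<open>18\<close> is \<open>9\<close> from the ghost sample times \<open>2\<close> from the two samples; the exponent has half
  of the threshold for the same reason, reduced by the discretization error \<open>4 B lam rho\<close>.
\<close>

lemma uniform_deviation:
  assumes F: "countable F" "F \<subseteq> borel_measurable borel" "\<And>f x. f \<in> F \<Longrightarrow> \<bar>f x\<bar> \<le> B"
    and V: "finite V" "\<And>l k. l \<in> V \<Longrightarrow> k \<in> I \<Longrightarrow> \<bar>l k\<bar> \<le> B"
    and sel: "\<And>l. l \<in> V \<Longrightarrow> {x \<in> space (PiM I (\<lambda>_. borel)). l \<in> sel x} \<in> sets (PiM I (\<lambda>_. borel))"
      "\<And>x. sel x \<subseteq> V" "\<And>x f. f \<in> F \<Longrightarrow> \<exists>l\<in>sel x. (\<Sum>k\<in>I. \<bar>l k - f (x k)\<bar>) \<le> rho"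
    and beta: "0 < beta" "2 * B\<^sup>2 * weight\<^sup>2 \<le> real (card I) * (8 * (weight - 1) * beta + beta\<^sup>2 / B\<^sup>2)"
  shows "emeasure sample {z \<in> space sample. \<exists>f\<in>F. real (card I) * eps < mean_bias f - lam * emp_excess f z}
    \<le> 18 * (ennreal (exp (- (rate * (real (card I) * (eps - beta) / 2 - 4 * B * lam * rho)))) *
        (\<integral>\<^sup>+ z. of_nat (card (sel (covariates I z))) \<partial>sample))"
proof -
  define t where "t = real (card I) * (eps - beta) / 2"
  let ?R = "ennreal (exp (- (rate * (t - 4 * B * lam * rho)))) * (\<integral>\<^sup>+ z. of_nat (card (sel (covariates I z))) \<partial>sample)"
  let ?E = "{p \<in> space (sample \<Otimes>\<^sub>M sample). \<exists>f\<in>F. real (card I) * (eps - beta) < weight * emp_bias f (snd p) - lam * emp_excess f (fst p)}"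
  have tt: "real (card I) * (eps - beta) = 2 * t" by (simp add: t_def)
  have "2 ^ card I * emeasure (sample \<Otimes>\<^sub>M sample) ?E \<le> 2 * (2 ^ card I * ?R)"
  proof -
    have "(\<Sum>J\<in>Pow I. emeasure sample {z \<in> space sample. \<exists>f\<in>F. t < mixed_deviation J (\<lambda>k. f (fst (z k))) z}) \<le> 2 ^ card I * ?R"
      by (rule mixed_union_bound[where V = V and sel = sel]) fact+
    then show ?thesis
      unfolding tt by (intro order_trans[OF swap_bound[OF F(1,2)] mult_left_mono]) auto
  qed
  then have "(2 ^ card I) * emeasure (sample \<Otimes>\<^sub>M sample) ?E \<le> (2 ^ card I) * (2 * ?R)"
    by (simp add: ac_simps)
  then have "emeasure (sample \<Otimes>\<^sub>M sample) ?E \<le> 2 * ?R"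
    by (subst (asm) ennreal_mult_le_mult_iff) (auto simp: power_eq_top_ennreal)
  then have "9 * emeasure (sample \<Otimes>\<^sub>M sample) ?E \<le> 9 * (2 * ?R)" by (rule mult_left_mono) simp
  also have "9 * (2 * ?R) = 18 * ?R" by (simp add: mult.assoc[symmetric])
  finally have "9 * emeasure (sample \<Otimes>\<^sub>M sample) ?E \<le> 18 * ?R" .
  moreover have "emeasure sample {z \<in> space sample. \<exists>f\<in>F. real (card I) * eps < mean_bias f - lam * emp_excess f z}
      \<le> 9 * emeasure (sample \<Otimes>\<^sub>M sample) ?E"
    by (rule ghost_symmetrization) fact+
  ultimately show ?thesis unfolding t_def by (rule order_trans[rotated])
qed

lemma eps_n_pos:
  assumes "1 \<le> n" "1 < c"
  shows "0 < eps_n n B c lam"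
proof -
  have "0 < c * (c + 1) * lam\<^sup>2 / real n" using assms lam_gt_1 by simp
  then have "sqrt ((lam - 1)\<^sup>2) < sqrt ((lam - 1)\<^sup>2 + c * (c + 1) * lam\<^sup>2 / real n)" by (intro real_sqrt_less_mono) simp
  then show ?thesis using lam_gt_1 B_pos by (simp add: eps_n_def)
qed

text \<open>
  With \<open>eps_n = 8 B\<^sup>2 e\<close>, the number \<open>e\<close> is the positive root of
  \<open>e\<^sup>2 + 2 (lam - 1) e = c (c + 1) lam\<^sup>2 / n\<close>. This is exactly the form of the right-hand side, and
  \<open>c (c + 1) \<ge> 2\<close>.
\<close>

lemma ghost_condition:
  assumes n: "1 \<le> n" and c: "1 < c" and eps: "eps_n n B c lam \<le> eps"
  shows "2 * B\<^sup>2 * weight\<^sup>2 \<le> real n * (8 * (weight - 1) * (eps / 8) + (eps / 8)\<^sup>2 / B\<^sup>2)"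
proof -
  define e where "e = - (lam - 1) + sqrt ((lam - 1)\<^sup>2 + c * (c + 1) * lam\<^sup>2 / real n)"
  have e0: "eps_n n B c lam = 8 * B\<^sup>2 * e" by (simp add: eps_n_def e_def)
  have epos: "0 < e" using eps_n_pos[OF n c] B_pos unfolding e0 by (simp add: zero_less_mult_iff)
  have "(e + (lam - 1))\<^sup>2 = (lam - 1)\<^sup>2 + c * (c + 1) * lam\<^sup>2 / real n"
    unfolding e_def using c by simp
  then have "e\<^sup>2 + 2 * (lam - 1) * e = c * (c + 1) * lam\<^sup>2 / real n"
    by (simp add: power2_eq_square algebra_simps)
  then have quad: "real n * (e\<^sup>2 + 2 * (lam - 1) * e) = c * (c + 1) * lam\<^sup>2" using n by simp
  have weight: "0 \<le> weight" "weight \<le> lam" "weight - 1 = (lam - 1) / 4" using lam_gt_1 by (auto simp: weight_def field_simps)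
  have "2 * weight\<^sup>2 \<le> c * (c + 1) * lam\<^sup>2"
    using weight c mult_mono[of 1 c 2 "c + 1"] by (intro mult_mono power_mono) auto
  then have "B\<^sup>2 * (2 * weight\<^sup>2) \<le> B\<^sup>2 * (real n * (e\<^sup>2 + 2 * (lam - 1) * e))"
    unfolding quad by (intro mult_left_mono) auto
  also have "\<dots> = real n * (8 * (weight - 1) * (B\<^sup>2 * e) + (B\<^sup>2 * e)\<^sup>2 / B\<^sup>2)"
    using B_pos by (simp add: weight(3) power2_eq_square field_simps)
  also have "\<dots> \<le> real n * (8 * (weight - 1) * (eps / 8) + (eps / 8)\<^sup>2 / B\<^sup>2)"
    using eps epos B_pos weight lam_gt_1 unfolding e0
    by (intro mult_left_mono add_mono divide_right_mono power_mono) auto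
  finally show ?thesis by (simp add: ac_simps)
qed

text \<open>
  Put \<open>q = 1 - 1/c\<close>. The radius \<open>2 r\<close> costs at most \<open>(1 - q) eps / 4\<close> per observation, which leaves
  \<open>7/16 - (1 - q)/4 \<ge> 7 q / 16\<close> of \<open>eps\<close>. On the other side \<open>q\<^sup>3 \<le> q\<close>, and the squared bracket in
  \<open>b_rate\<close> is at least \<open>lam\<^sup>2\<close>; so \<open>b_rate \<le> q (lam - 1) / (32 B\<^sup>2 lam\<^sup>3)\<close>, and this is below
  \<open>rate * 7 q / 16 = 7 q (lam - 1) / (192 B\<^sup>2 lam\<^sup>3)\<close>.
\<close>

lemma rate_bound:
  assumes n: "1 \<le> n" and c: "1 < c" and eps: "eps_n n B c lam \<le> eps"
    and r: "r = 1 / 2 ^ 5 * (1 / B) * (1 / (lam * (c - 1) + 1)) * (1 - 1 / c) * eps_n n B c lam"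
  shows "real n * b_rate B c lam * eps \<le> rate * (real n * (eps - eps / 8) / 2 - 4 * B * lam * (real n * (2 * r)))"
proof -
  define q where "q = 1 - 1 / c"
  have q: "0 < q" "q < 1" using c by (auto simp: q_def)
  have eps0: "0 < eps" using eps_n_pos[OF n c] eps by simp
  have lam: "1 < lam" by (rule lam_gt_1)
  have den: "0 < lam * (c - 1) + 1" using lam c by (simp add: add_pos_pos)
  have "lam * q / (lam * (c - 1) + 1) \<le> 1 - q"
  proof -
    have "lam * q / (lam * (c - 1) + 1) = (lam * (c - 1) / (lam * (c - 1) + 1)) * (1 / c)"
      using c by (simp add: q_def diff_divide_distrib right_diff_distrib)
    also have "\<dots> \<le> 1 * (1 / c)" using c den by (intro mult_right_mono) auto
    finally show ?thesis by (simp add: q_def)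
  qed
  then have "lam * q / (lam * (c - 1) + 1) * eps_n n B c lam \<le> (1 - q) * eps"
    using eps eps_n_pos[OF n c] q by (intro mult_mono) auto
  moreover have "8 * B * lam * r = lam * q / (lam * (c - 1) + 1) * eps_n n B c lam / 4"
    using B_pos den unfolding r q_def[symmetric] by (simp add: divide_simps)
  moreover have "L \<le> Y / 4" if "X \<le> Y" "L = X / 4" for L X Y :: real using that by simp
  ultimately have loss: "8 * B * lam * r \<le> (1 - q) * eps / 4" by blast
  have b: "b_rate B c lam \<le> rate * (7 * q / 16)"
  proof -
    define m where "m = 1 / 3 * (1 - 1 / c) * (1 - 1 / lam) + (2 * lam - 1)"
    have "0 \<le> 1 / 3 * (1 - 1 / c) * (1 - 1 / lam)" using c lam by (intro mult_nonneg_nonneg) auto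
    then have m: "lam \<le> m" using lam unfolding m_def by linarith
    then have "lam\<^sup>2 \<le> m\<^sup>2" using lam by (intro power_mono) auto
    then have "1 / m\<^sup>2 \<le> 1 / lam\<^sup>2" using lam by (intro frac_le) auto
    moreover have "q ^ 3 \<le> q" using q by (simp add: power_le_one_iff power3_eq_cube mult_le_one mult_left_le)
    ultimately have "b_rate B c lam \<le> 1 / (2 ^ 5 * B\<^sup>2) * (1 / lam\<^sup>2) * q * (1 - 1 / lam)"
      unfolding b_rate_def unfolding m_def[symmetric] unfolding q_def[symmetric] using q lam
      by (intro mult_mono mult_nonneg_nonneg) auto
    also have "\<dots> = 6 / 192 * (q * (lam - 1) / (B\<^sup>2 * lam ^ 3))"
      using lam B_pos by (simp add: field_simps power2_eq_square power3_eq_cube)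
    also have "\<dots> \<le> 7 / 192 * (q * (lam - 1) / (B\<^sup>2 * lam ^ 3))"
      using q lam by (intro mult_right_mono divide_nonneg_nonneg) auto
    also have "\<dots> = rate * (7 * q / 16)" by (simp add: rate_def)
    finally show ?thesis .
  qed
  have "real n * b_rate B c lam * eps = (real n * eps) * b_rate B c lam" by simp
  also have "\<dots> \<le> (real n * eps) * (rate * (7 * q / 16))"
    using b eps0 by (intro mult_left_mono) auto
  also have "\<dots> = rate * real n * (7 * q / 16 * eps)" by simp
  also have "\<dots> \<le> rate * real n * (7 / 16 * eps - 8 * B * lam * r)"
  proof (intro mult_left_mono)
    have "q * eps \<le> 1 * eps" using q eps0 by (intro mult_right_mono) auto
    then show "7 * q / 16 * eps \<le> 7 / 16 * eps - 8 * B * lam * r"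
      using loss by (simp add: algebra_simps)
  qed (use rate_pos in auto)
  also have "\<dots> = rate * (real n * (eps - eps / 8) / 2 - 4 * B * lam * (real n * (2 * r)))"
    by (simp add: algebra_simps)
  finally show ?thesis .
qed

end

section \<open>Conditional and extended expectations\<close>

lemma (in prob_space) regression_identity:
  fixes X :: "'a \<Rightarrow> 'b::topological_space"
  assumes X [measurable]: "X \<in> measurable M borel" and Y: "Y \<in> borel_measurable M" "\<And>\<omega>. \<bar>Y \<omega>\<bar> \<le> B"
    and ce: "AE \<omega> in M. p (X \<omega>) = real_cond_exp M (vimage_algebra (space M) X borel) Y \<omega>"
    and p: "p \<in> borel_measurable borel"
    and u: "u \<in> borel_measurable borel" "bounded (range u)"
  shows "(\<integral>\<omega>. u (X \<omega>) * Y \<omega> \<partial>M) = (\<integral>\<omega>. u (X \<omega>) * p (X \<omega>) \<partial>M)"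
proof -
  let ?F = "vimage_algebra (space M) X borel"
  note [measurable] = Y(1) p u(1)
  have sub: "subalgebra M ?F"
    unfolding subalgebra_def using sets_image_in_sets[OF refl X] by simp
  interpret F: finite_measure_subalgebra M ?F
    by standard (rule sub)
  have uF: "(\<lambda>\<omega>. u (X \<omega>)) \<in> borel_measurable ?F"
    by (rule measurable_compose[OF measurable_vimage_algebra1 u(1)]) auto
  obtain C where C: "\<And>x. \<bar>u x\<bar> \<le> C" using u(2) by (auto simp: bounded_iff)
  have "integrable M (\<lambda>\<omega>. u (X \<omega>) * Y \<omega>)"
  proof (rule integrable_const_bound[where B = "C * B"])
    have "\<bar>u (X \<omega>) * Y \<omega>\<bar> \<le> C * B" for \<omega>
      unfolding abs_mult using C[of "X \<omega>"] Y(2)[of \<omega>] by (intro mult_mono) auto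
    then show "AE \<omega> in M. norm (u (X \<omega>) * Y \<omega>) \<le> C * B" by simp
  qed measurable
  then have "(\<integral>\<omega>. u (X \<omega>) * Y \<omega> \<partial>M) = (\<integral>\<omega>. u (X \<omega>) * real_cond_exp M ?F Y \<omega> \<partial>M)"
    using F.real_cond_exp_intg(2)[OF _ uF Y(1)] by simp
  also have "\<dots> = (\<integral>\<omega>. u (X \<omega>) * p (X \<omega>) \<partial>M)"
    using ce by (intro integral_cong_AE) (auto elim!: eventually_mono)
  finally show ?thesis .
qed

text \<open>
  On a probability space, subtracting a constant cannot make an infinite integral finite.
\<close>

lemma nn_integral_shift_infinite:
  assumes "prob_space M" and [measurable]: "f \<in> borel_measurable M" "q \<in> borel_measurable M"
    and le: "\<And>\<omega>. q \<omega> - C \<le> f \<omega>" and q: "(\<integral>\<^sup>+\<omega>. ennreal (q \<omega>) \<partial>M) = \<infinity>"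
  shows "(\<integral>\<^sup>+\<omega>. ennreal (f \<omega>) \<partial>M) = \<infinity>"
proof (rule ccontr)
  interpret prob_space M by fact
  assume fin: "\<not> ?thesis"
  have "ennreal (q \<omega>) \<le> ennreal (f \<omega>) + ennreal \<bar>C\<bar>" for \<omega>
  proof -
    have "q \<omega> \<le> max 0 (f \<omega>) + \<bar>C\<bar>" using le[of \<omega>] by linarith
    then have "ennreal (q \<omega>) \<le> ennreal (max 0 (f \<omega>) + \<bar>C\<bar>)" by (rule ennreal_leI)
    also have "\<dots> = ennreal (f \<omega>) + ennreal \<bar>C\<bar>" by (subst ennreal_plus) (auto simp: max_def ennreal_neg)
    finally show ?thesis .
  qed
  then have "(\<integral>\<^sup>+\<omega>. ennreal (q \<omega>) \<partial>M) \<le> (\<integral>\<^sup>+\<omega>. ennreal (f \<omega>) + ennreal \<bar>C\<bar> \<partial>M)" by (rule nn_integral_mono)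
  also have "\<dots> = (\<integral>\<^sup>+\<omega>. ennreal (f \<omega>) \<partial>M) + ennreal \<bar>C\<bar>"
    by (subst nn_integral_add) (auto simp: emeasure_space_1)
  also have "\<dots> < \<infinity>" using fin by (simp add: less_top)
  finally show False using q by simp
qed

lemma (in prob_space) ext_expectation_MInf:
  assumes [measurable]: "f \<in> borel_measurable M" and ub: "\<And>\<omega>. f \<omega> \<le> C"
    and inf: "(\<integral>\<^sup>+\<omega>. ennreal (- f \<omega>) \<partial>M) = \<infinity>"
  shows "ext_expectation M f = - \<infinity>"
proof -
  have "(\<integral>\<^sup>+\<omega>. ennreal (f \<omega>) \<partial>M) \<le> (\<integral>\<^sup>+\<omega>. ennreal C \<partial>M)"
    using ub by (intro nn_integral_mono ennreal_leI)
  then have "(\<integral>\<^sup>+\<omega>. ennreal (f \<omega>) \<partial>M) < \<infinity>" by (simp add: emeasure_space_1 le_less_trans)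
  then obtain q where "0 \<le> q" "(\<integral>\<^sup>+\<omega>. ennreal (f \<omega>) \<partial>M) = ennreal q" by (metis ennreal_cases infinity_ennreal_def less_irrefl)
  then show ?thesis unfolding ext_expectation_def inf by simp
qed

lemma trunc_family_countable_measurable:
  assumes "countable G" "G \<subseteq> borel_measurable borel"
  shows "countable (trunc_family B G)" "trunc_family B G \<subseteq> borel_measurable borel"
proof -
  show "countable (trunc_family B G)" using assms(1) by (simp add: trunc_family_def)
  show "trunc_family B G \<subseteq> borel_measurable borel"
    using assms(2) by (auto simp: trunc_family_def intro: measurable_compose[OF _ trunc_measurable])
qed

text \<open>
  \<open>trunc B y\<close> is a fixed point of the truncation, which is nonexpansive.
\<close>

lemma trunc_loss_le:
  assumes "0 \<le> B"
  shows "(trunc B a - trunc B y)\<^sup>2 \<le> (a - trunc B y)\<^sup>2"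
proof -
  have "trunc B (trunc B y) = trunc B y" using trunc_bounds[OF assms] by (intro trunc_id)
  then show ?thesis using trunc_nonexpansive[of B a "trunc B y"] by (simp add: abs_le_square_iff)
qed

context truncated_regression begin

text \<open>
  The cross term \<open>2 (f - phi k) (phi k - y)\<close> of the excess loss integrates to \<open>0\<close> by the regression
  property.
\<close>

lemma integral_excess_at:
  assumes [measurable]: "f \<in> borel_measurable borel" and f: "\<And>x. \<bar>f x\<bar> \<le> B"
  shows "integrable (mu k) (\<lambda>z. excess_at k (f (fst z)) z)"
    "(\<integral>z. excess_at k (f (fst z)) z \<partial>mu k) = (\<integral>z. sq_bias k (f (fst z)) (fst z) \<partial>mu k)"
proof -
  define u where "u x = 2 * (f x - phi k x)" for x
  have [measurable]: "u \<in> borel_measurable borel" unfolding u_def by measurable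
  have ub: "\<bar>u x\<bar> \<le> 4 * B" for x using f[of x] abs_phi[of k x] by (simp add: u_def abs_le_iff)
  have ig: "integrable (mu k) (\<lambda>z. sq_bias k (f (fst z)) (fst z))"
    using sq_bias_bounds f by (intro M.integrable_const_bound[where B = "4 * B\<^sup>2"]) auto
  have ip: "integrable (mu k) (\<lambda>z. u (fst z) * phi k (fst z))"
  proof (rule M.integrable_const_bound[where B = "4 * B * B"])
    have "\<bar>u x * phi k x\<bar> \<le> 4 * B * B" for x
      unfolding abs_mult using ub abs_phi B_pos by (intro mult_mono) auto
    then show "AE z in mu k. norm (u (fst z) * phi k (fst z)) \<le> 4 * B * B" by simp
  qed measurable
  have iy: "integrable (mu k) (\<lambda>z. u (fst z) * trunc B (snd z))"
  proof (rule M.integrable_const_bound[where B = "4 * B * B"])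
    have "\<bar>u x * trunc B y\<bar> \<le> 4 * B * B" for x y
      unfolding abs_mult using ub trunc_bounds[of B y] B_pos by (intro mult_mono) auto
    then show "AE z in mu k. norm (u (fst z) * trunc B (snd z)) \<le> 4 * B * B" by simp
  qed measurable
  have eq: "excess_at k (f (fst z)) z = sq_bias k (f (fst z)) (fst z) + (u (fst z) * phi k (fst z) - u (fst z) * trunc B (snd z))" for z
    by (simp add: excess_at_eq sq_bias_def u_def power2_eq_square algebra_simps)
  have "bounded (range u)" using ub by (auto simp: bounded_iff)
  then have "(\<integral>z. u (fst z) * trunc B (snd z) \<partial>mu k) = (\<integral>z. u (fst z) * phi k (fst z) \<partial>mu k)"
    by (intro regression) measurable
  then show "(\<integral>z. excess_at k (f (fst z)) z \<partial>mu k) = (\<integral>z. sq_bias k (f (fst z)) (fst z) \<partial>mu k)"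
    unfolding eq using ig ip iy by simp
  show "integrable (mu k) (\<lambda>z. excess_at k (f (fst z)) z)"
    unfolding eq using ig ip iy by simp
qed

text \<open>
  Transfers the inequality from a countable subfamily to its pointwise limits.
\<close>

lemma deviation_limit:
  assumes f: "\<And>i::nat. f i \<in> borel_measurable borel" "\<And>i x. \<bar>f i x\<bar> \<le> B"
    and g: "g \<in> borel_measurable borel" and lim: "\<And>x. (\<lambda>i. f i x) \<longlonglongrightarrow> g x"
    and bound: "\<And>i. mean_bias (f i) - lam * emp_excess (f i) z \<le> t"
  shows "mean_bias g - lam * emp_excess g z \<le> t"
proof (rule LIMSEQ_le_const2)
  note [measurable] = f(1) g
  have "(\<lambda>i. \<integral>z. sq_bias k (f i (fst z)) (fst z) \<partial>mu k) \<longlonglongrightarrow> (\<integral>z. sq_bias k (g (fst z)) (fst z) \<partial>mu k)" for k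
  proof (rule integral_dominated_convergence[where w = "\<lambda>_. 4 * B\<^sup>2"])
    show "AE z in mu k. (\<lambda>i. sq_bias k (f i (fst z)) (fst z)) \<longlonglongrightarrow> sq_bias k (g (fst z)) (fst z)"
      unfolding sq_bias_def by (intro AE_I2 tendsto_intros lim)
    show "AE z in mu k. norm (sq_bias k (f i (fst z)) (fst z)) \<le> 4 * B\<^sup>2" for i
      using sq_bias_bounds f(2) by (intro AE_I2) auto
  qed (auto simp: M.finite_measure_axioms)
  then have "(\<lambda>i. mean_bias (f i)) \<longlonglongrightarrow> mean_bias g" unfolding mean_bias_def by (intro tendsto_sum)
  moreover have "(\<lambda>i. emp_excess (f i) z) \<longlonglongrightarrow> emp_excess g z"
    unfolding emp_excess_def excess_at_def by (intro tendsto_intros lim)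
  ultimately show "(\<lambda>i. mean_bias (f i) - lam * emp_excess (f i) z) \<longlonglongrightarrow> mean_bias g - lam * emp_excess g z"
    by (intro tendsto_intros)
  show "\<exists>N. \<forall>i\<ge>N. mean_bias (f i) - lam * emp_excess (f i) z \<le> t" using bound by blast
qed

end

section \<open>The generalization bound\<close>

theorem theorem4p1:
  fixes M :: "'w measure"
    and Z Z' :: "nat \<Rightarrow> 'w \<Rightarrow> 'a::polish_space \<times> real"
    and X :: "nat \<Rightarrow> 'w \<Rightarrow> 'a" and Y :: "nat \<Rightarrow> 'w \<Rightarrow> real"
    and n :: nat and B c lam \<delta> :: real
    and G :: "('a \<Rightarrow> real) set"
    and \<phi> :: "nat \<Rightarrow> 'a \<Rightarrow> real"
    and ghat :: "(nat \<Rightarrow> 'a \<times> real) \<Rightarrow> 'a \<Rightarrow> real"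
    and gtilde :: "'a \<Rightarrow> real"
  defines "X \<equiv> \<lambda>k \<omega>. fst (Z k \<omega>)" and "Y \<equiv> \<lambda>k \<omega>. snd (Z k \<omega>)"
  assumes "prob_space M" and "n \<ge> 1" and "B > 0"
    and indep: "prob_space.indep_vars M (\<lambda>_. borel) Z {1..n}"
    and copy_law:
      "distr M (\<Pi>\<^sub>M k\<in>{1..n}. borel) (\<lambda>\<omega>. \<lambda>k\<in>{1..n}. Z' k \<omega>) =
       distr M (\<Pi>\<^sub>M k\<in>{1..n}. borel) (\<lambda>\<omega>. \<lambda>k\<in>{1..n}. Z k \<omega>)"
    and copy_indep:
      "prob_space.indep_var M
         (\<Pi>\<^sub>M k\<in>{1..n}. borel) (\<lambda>\<omega>. \<lambda>k\<in>{1..n}. Z' k \<omega>)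
         (\<Pi>\<^sub>M k\<in>{1..n}. borel) (\<lambda>\<omega>. \<lambda>k\<in>{1..n}. Z k \<omega>)"
    and "G \<noteq> {}" and "G \<subseteq> borel_measurable borel" and "pointwise_measurable G"
    and phi_borel: "\<And>k. k \<in> {1..n} \<Longrightarrow> \<phi> k \<in> borel_measurable borel"
    and phi_bounded: "\<And>k x. k \<in> {1..n} \<Longrightarrow> \<phi> k x \<in> {- B..B}"
    and phi_cond_exp: "\<And>k. k \<in> {1..n} \<Longrightarrow>
      AE \<omega> in M. \<phi> k (X k \<omega>) =
        real_cond_exp M (vimage_algebra (space M) (X k) borel) (\<lambda>\<omega>. trunc B (Y k \<omega>)) \<omega>"
    and ghat_argmin: "\<And>\<omega>. \<omega> \<in> space M \<Longrightarrow>
      is_arg_min (\<lambda>g. \<Sum>k=1..n. \<bar>g (X k \<omega>) - trunc B (Y k \<omega>)\<bar>\<^sup>2) (\<lambda>g. g \<in> G)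
        (ghat (\<lambda>k\<in>{1..n}. Z k \<omega>))"
    and gtilde_argmin:
      "is_arg_min (\<lambda>g. \<Sum>k=1..n. \<integral>\<^sup>+ \<omega>. ennreal (\<bar>g (X k \<omega>) - trunc B (Y k \<omega>)\<bar>\<^sup>2) \<partial>M)
        (\<lambda>g. g \<in> G) gtilde"
    and "c > 1" and "lam > 1" and "\<delta> \<in> {0<..<1}"
  shows "\<exists>E\<in>sets M. measure M E \<ge> 1 - \<delta> \<and> (\<forall>\<omega>\<in>E.
    ext_expectation M (\<lambda>\<omega>'. \<Sum>k=1..n.
        excess B (\<phi> k) (\<lambda>x. trunc B (ghat (\<lambda>j\<in>{1..n}. Z j \<omega>) x)) (Z' k \<omega>')
        - excess B (\<phi> k) gtilde (Z' k \<omega>'))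
    \<le> (\<Sum>k=1..n. ereal (lam * excess B (\<phi> k) gtilde (Z k \<omega>))
          - ext_expectation M (\<lambda>\<omega>'. excess B (\<phi> k) gtilde (Z k \<omega>')))
      + max (ereal (real n * eps_n n B c lam))
          (ereal (1 / b_rate B c lam) *
            (ext_ln (a_cov M X n B G c lam (eps_n n B c lam)) + ereal (ln (1 / \<delta>)))))"
proof -
  interpret prob_space M by fact
  have n1: "1 \<le> n" and B: "0 < B" and c: "1 < c" and lam: "1 < lam" and delta: "0 < \<delta>" "\<delta> < 1"
    using assms by auto
  \<comment> \<open>Indices outside \<open>{1..n}\<close> borrow the data of index \<open>1\<close>, since the model asks for a law at every index\<close>
  define \<kappa> where "\<kappa> k = (if k \<in> {1..n} then k else 1)" for k :: nat
  have \<kappa>: "\<kappa> k \<in> {1..n}" "k \<in> {1..n} \<Longrightarrow> \<kappa> k = k" for k using n1 by (auto simp: \<kappa>_def)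
  define mu where "mu k = distr M borel (Z (\<kappa> k))" for k
  define \<psi> where "\<psi> k = \<phi> (\<kappa> k)" for k
  have Zm: "Z k \<in> measurable M borel" if "k \<in> {1..n}" for k
    using indep that unfolding indep_vars_def2 by auto
  have borel2: "sets (borel :: ('a \<times> real) measure) = sets (borel \<Otimes>\<^sub>M borel)"
    by (rule arg_cong[where f = sets], rule borel_prod[symmetric])
  interpret R: truncated_regression "{1..n}" mu \<psi> B lam
  proof (rule truncated_regression.intro)
    show "prob_space (mu k)" for k unfolding mu_def using Zm \<kappa>(1) by (intro prob_space_distr) auto
    show "sets (mu k) = sets (borel \<Otimes>\<^sub>M borel)" for k by (simp add: mu_def borel2)
    show "\<psi> k \<in> borel_measurable borel" for k unfolding \<psi>_def by (rule phi_borel[OF \<kappa>(1)])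
    show "- B \<le> \<psi> k x" "\<psi> k x \<le> B" for k x using phi_bounded[OF \<kappa>(1)[of k], of x] by (auto simp: \<psi>_def)
    fix k and u :: "'a \<Rightarrow> real" assume u: "u \<in> borel_measurable borel" "bounded (range u)"
    have [measurable]: "Z (\<kappa> k) \<in> measurable M (borel \<Otimes>\<^sub>M borel)"
      using Zm[OF \<kappa>(1)] measurable_cong_sets[OF refl borel2] by blast
    note [measurable] = u(1) phi_borel[OF \<kappa>(1)]
    have "(\<integral>\<omega>. u (X (\<kappa> k) \<omega>) * trunc B (Y (\<kappa> k) \<omega>) \<partial>M) = (\<integral>\<omega>. u (X (\<kappa> k) \<omega>) * \<phi> (\<kappa> k) (X (\<kappa> k) \<omega>) \<partial>M)"
    proof (rule regression_identity[OF _ _ _ phi_cond_exp[OF \<kappa>(1)] phi_borel[OF \<kappa>(1)] u])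
      show "X (\<kappa> k) \<in> borel_measurable M" unfolding X_def by measurable
      show "(\<lambda>\<omega>. trunc B (Y (\<kappa> k) \<omega>)) \<in> borel_measurable M" unfolding Y_def by measurable
      show "\<bar>trunc B (Y (\<kappa> k) \<omega>)\<bar> \<le> B" for \<omega> using trunc_bounds[of B "Y (\<kappa> k) \<omega>"] B by (simp add: abs_le_iff)
    qed
    moreover have "(\<lambda>z. u (fst z) * trunc B (snd z)) \<in> borel_measurable (borel :: ('a \<times> real) measure)"
      "(\<lambda>z. u (fst z) * \<phi> (\<kappa> k) (fst z)) \<in> borel_measurable (borel :: ('a \<times> real) measure)"
      unfolding borel_prod[symmetric] by measurable
    ultimately show "(\<integral>z. u (fst z) * trunc B (snd z) \<partial>mu k) = (\<integral>z. u (fst z) * \<psi> k (fst z) \<partial>mu k)"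
      unfolding mu_def \<psi>_def X_def Y_def using Zm[OF \<kappa>(1)] by (simp add: integral_distr)
  qed (use n1 B lam in auto)
  define zv where "zv \<omega> = (\<lambda>k\<in>{1..n}. Z k \<omega>)" for \<omega>
  have sample_sets: "sets R.sample = sets (PiM {1..n} (\<lambda>_. borel))"
    by (intro sets_PiM_cong) (auto simp: mu_def)
  have zv_borel: "zv \<in> measurable M (PiM {1..n} (\<lambda>_. borel))"
    unfolding zv_def using Zm by (intro measurable_restrict) auto
  then have zv [measurable]: "zv \<in> measurable M R.sample"
    using measurable_cong_sets[OF refl sample_sets] by blast
  have law: "distr M R.sample zv = R.sample"
  proof -
    have "distr M R.sample zv = distr M (PiM {1..n} (\<lambda>_. borel)) zv"
      by (rule distr_cong[OF refl sample_sets refl])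
    also have "\<dots> = PiM {1..n} (\<lambda>k. distr M borel (Z k))"
      unfolding zv_def
      by (rule iffD1[OF indep_vars_iff_distr_eq_PiM' indep]) (use n1 Zm in auto)
    also have "\<dots> = R.sample" by (intro PiM_cong) (auto simp: mu_def \<kappa>(2))
    finally show ?thesis .
  qed
  define zv' where "zv' \<omega> = (\<lambda>k\<in>{1..n}. Z' k \<omega>)" for \<omega>
  have zv': "zv' \<in> measurable M (PiM {1..n} (\<lambda>_. borel))"
    using indep_var_rv1[OF copy_indep] unfolding zv'_def .
  have Z'm: "Z' k \<in> measurable M borel" if "k \<in> {1..n}" for k
  proof -
    have "(\<lambda>\<omega>. zv' \<omega> k) \<in> measurable M borel"
      using that by (intro measurable_compose[OF zv' measurable_component_singleton])
    then show ?thesis using that by (simp add: zv'_def)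
  qed
  have law': "distr M borel (Z' k) = mu k" if k: "k \<in> {1..n}" for k
  proof -
    have "distr M borel (Z' k) = distr M borel ((\<lambda>x. x k) \<circ> zv')" using k by (simp add: zv'_def comp_def)
    also have "\<dots> = distr (distr M (PiM {1..n} (\<lambda>_. borel)) zv') borel (\<lambda>x. x k)"
      using k by (intro distr_distr[symmetric] zv' measurable_component_singleton)
    also have "distr M (PiM {1..n} (\<lambda>_. borel)) zv' = distr M (PiM {1..n} (\<lambda>_. borel)) zv"
      using copy_law unfolding zv'_def zv_def .
    also have "distr \<dots> borel (\<lambda>x. x k) = distr M borel ((\<lambda>x. x k) \<circ> zv)"
      using k by (intro distr_distr zv_borel measurable_component_singleton)
    also have "\<dots> = mu k" using k by (simp add: zv_def comp_def mu_def \<kappa>(2))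
    finally show ?thesis .
  qed
  have excess: "excess B (\<phi> k) g z = R.excess_at k (g (fst z)) z" if "k \<in> {1..n}" for k g z
    using that by (cases z) (simp add: excess_def R.excess_at_def \<psi>_def \<kappa>(2))

  define e0 where "e0 = eps_n n B c lam"
  have e0: "0 < e0" unfolding e0_def by (rule R.eps_n_pos[OF n1 c])
  define b where "b = b_rate B c lam"
  have b: "0 < b"
  proof -
    have "0 < 1 / 3 * (1 - 1 / c) * (1 - 1 / lam) + (2 * lam - 1)"
      using c lam by (intro add_nonneg_pos mult_nonneg_nonneg) auto
    then show ?thesis unfolding b_def b_rate_def using c lam B by (intro mult_pos_pos divide_pos_pos) auto
  qed
  define r where "r = 1 / 2 ^ 5 * (1 / B) * (1 / (lam * (c - 1) + 1)) * (1 - 1 / c) * e0"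
  have r: "0 < r"
    unfolding r_def using e0 B c lam by (intro mult_pos_pos divide_pos_pos add_pos_pos) auto
  define a where "a = a_cov M X n B G c lam e0"
  let ?bound = "max (ereal (real n * e0)) (ereal (1 / b) * (ext_ln a + ereal (ln (1 / \<delta>))))"
  let ?lhs = "\<lambda>\<omega>. ext_expectation M (\<lambda>\<omega>'. \<Sum>k=1..n. excess B (\<phi> k) (\<lambda>x. trunc B (ghat (zv \<omega>) x)) (Z' k \<omega>') - excess B (\<phi> k) gtilde (Z' k \<omega>'))"
  let ?rhs = "\<lambda>\<omega>. \<Sum>k=1..n. ereal (lam * excess B (\<phi> k) gtilde (Z k \<omega>)) - ext_expectation M (\<lambda>\<omega>'. excess B (\<phi> k) gtilde (Z k \<omega>'))"
  have "\<exists>E\<in>sets M. measure M E \<ge> 1 - \<delta> \<and> (\<forall>\<omega>\<in>E. ?lhs \<omega> \<le> ?rhs \<omega> + ?bound)"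
  proof (cases "a = \<infinity>")
    case True
    then have "?bound = \<infinity>" using b by (simp add: ext_ln_def max_def)
    then show ?thesis using prob_space delta by (intro bexI[of _ "space M"]) auto
  next
    case False
    then obtain a' where a': "0 \<le> a'" "a = ennreal a'" by (metis ennreal_cases infinity_ennreal_def)
    \<comment> \<open>For \<open>a' = 0\<close> the extended logarithm is \<open>-\<infinity>\<close>, and the maximum is its first argument\<close>
    define mx where "mx = (if a' = 0 then real n * e0 else max (real n * e0) ((1 / b) * (ln a' + ln (1 / \<delta>))))"
    have bound: "?bound = ereal mx"
      using a' b by (auto simp: mx_def ext_ln_def max_def)
    define eps where "eps = mx / real n"
    have mx: "mx = real n * eps" using n1 by (simp add: eps_def)
    have "real n * e0 \<le> mx" by (simp add: mx_def)
    then have eps: "e0 \<le> eps" using n1 by (simp add: eps_def field_simps)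
    obtain G0 where G0: "countable G0" "G0 \<subseteq> G"
      "\<And>g. g \<in> G \<Longrightarrow> \<exists>s. (\<forall>i::nat. s i \<in> G0) \<and> (\<forall>x. (\<lambda>i. s i x) \<longlonglongrightarrow> g x)"
      using \<open>pointwise_measurable G\<close> unfolding pointwise_measurable_def by blast
    have Gm: "g \<in> borel_measurable borel" if "g \<in> G" for g using that \<open>G \<subseteq> borel_measurable borel\<close> by auto
    \<comment> \<open>A countable family, so that the exceptional event is measurable\<close>
    define F where "F = trunc_family B G0"
    have F: "countable F" "F \<subseteq> borel_measurable borel"
      unfolding F_def using G0 Gm by (intro trunc_family_countable_measurable; auto)+
    have Fb: "\<bar>f x\<bar> \<le> B" if "f \<in> F" for f x
      using that trunc_bounds[of B] B by (auto simp: F_def trunc_family_def abs_le_iff minus_le_iff)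
    have FF: "F \<subseteq> trunc_family B G" using G0 by (auto simp: F_def trunc_family_def)
    obtain V sel where V: "finite V" "\<And>l k. l \<in> V \<Longrightarrow> k \<in> {1..n} \<Longrightarrow> \<bar>l k\<bar> \<le> B"
      and sel: "\<And>l. l \<in> V \<Longrightarrow> {x \<in> space (PiM {1..n} (\<lambda>_. borel)). l \<in> sel x} \<in> sets (PiM {1..n} (\<lambda>_. borel :: 'a measure))"
      "\<And>x. sel x \<subseteq> V"
      "\<And>x f. f \<in> F \<Longrightarrow> \<exists>l\<in>sel x. (\<Sum>k=1..n. \<bar>l k - f (x k)\<bar>) \<le> real n * (2 * r)"
      and card_meas: "(\<lambda>x. of_nat (card (sel x)) :: ennreal) \<in> borel_measurable (PiM {1..n} (\<lambda>_. borel))"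
      and card_le: "\<And>x. of_nat (card (sel x)) \<le> ennreal_of_enat (covering_number n (trunc_family B G) x r)"
    proof (rule measurable_cover_selection[OF n1 less_imp_le[OF B] r F _ FF])
      show "\<And>f x. f \<in> F \<Longrightarrow> \<bar>f x\<bar> \<le> B" by (rule Fb)
    qed (rule that)
    note [measurable] = card_meas
    define Bad where "Bad = {z \<in> space R.sample. \<exists>f\<in>F. real (card {1..n}) * eps < R.mean_bias f - lam * R.emp_excess f z}"
    have Bad: "Bad \<in> sets R.sample"
    proof -
      have [measurable]: "R.emp_excess f \<in> borel_measurable R.sample" if "f \<in> F" for f
        by (rule R.emp_measurable(2)) (use F that in auto)
      show ?thesis unfolding Bad_def by (intro R.pred_exists_measurable F(1)) measurable
    qed
    have card_a: "18 * (\<integral>\<^sup>+ z. of_nat (card (sel (R.covariates {1..n} z))) \<partial>R.sample) \<le> a"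
    proof -
      have "18 * (\<integral>\<^sup>+ z. of_nat (card (sel (R.covariates {1..n} z))) \<partial>R.sample)
        = (\<integral>\<^sup>+ z. 18 * of_nat (card (sel (R.covariates {1..n} z))) \<partial>R.sample)"
        by (intro nn_integral_cmult[symmetric]) measurable
      also have "\<dots> = (\<integral>\<^sup>+ \<omega>. 18 * of_nat (card (sel (R.covariates {1..n} (zv \<omega>)))) \<partial>M)"
        by (subst law[symmetric], subst nn_integral_distr) measurable
      also have "\<dots> \<le> (\<integral>\<^sup>+ \<omega>. A_cov n B G (\<lambda>k. X k \<omega>) c lam e0 \<partial>M)"
      proof (intro nn_integral_mono)
        fix \<omega>
        have "covering_number n (trunc_family B G) (R.covariates {1..n} (zv \<omega>)) r = covering_number n (trunc_family B G) (\<lambda>k. X k \<omega>) r"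
          unfolding covering_number_def by (simp add: zv_def X_def)
        then have "of_nat (card (sel (R.covariates {1..n} (zv \<omega>)))) \<le> ennreal_of_enat (covering_number n (trunc_family B G) (\<lambda>k. X k \<omega>) r)"
          using card_le[of "R.covariates {1..n} (zv \<omega>)"] by simp
        moreover have "(18::ennreal) \<le> ennreal (2 * (c + 1) * (2 * c + 3))"
        proof -
          \<comment> \<open>The prefactor exceeds \<open>18\<close> because \<open>c > 1\<close>\<close>
          have "2 * 2 * 5 \<le> 2 * (c + 1) * (2 * c + 3)" using c by (intro mult_mono) auto
          then have "ennreal 18 \<le> ennreal (2 * (c + 1) * (2 * c + 3))" by (intro ennreal_leI) simp
          then show ?thesis by simp
        qed
        ultimately show "18 * of_nat (card (sel (R.covariates {1..n} (zv \<omega>)))) \<le> A_cov n B G (\<lambda>k. X k \<omega>) c lam e0"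
          unfolding A_cov_def r_def[symmetric] by (intro mult_mono) auto
      qed
      finally show ?thesis by (simp add: a_def a_cov_def)
    qed
    have eps0: "0 < eps" using e0 eps by simp
    have Bad_le: "emeasure R.sample Bad \<le> ennreal (exp (- (b * mx))) * a"
    proof -
      have "emeasure R.sample Bad \<le> 18 * (ennreal (exp (- (R.rate * (real (card {1..n}) * (eps - eps / 8) / 2 - 4 * B * lam * (real n * (2 * r)))))) *
        (\<integral>\<^sup>+ z. of_nat (card (sel (R.covariates {1..n} z))) \<partial>R.sample))"
        unfolding Bad_def
      proof (rule R.uniform_deviation[where V = V])
        show "0 < eps / 8" using eps0 by simp
        show "2 * B\<^sup>2 * R.weight\<^sup>2 \<le> real (card {1..n}) * (8 * (R.weight - 1) * (eps / 8) + (eps / 8)\<^sup>2 / B\<^sup>2)"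
          using R.ghost_condition[OF n1 c, of eps] eps unfolding e0_def by simp
      qed (fact F Fb V sel)+
      also have "\<dots> = ennreal (exp (- (R.rate * (real n * (eps - eps / 8) / 2 - 4 * B * lam * (real n * (2 * r)))))) *
         (18 * (\<integral>\<^sup>+ z. of_nat (card (sel (R.covariates {1..n} z))) \<partial>R.sample))"
        by (simp add: ac_simps)
      also have "\<dots> \<le> ennreal (exp (- (b * mx))) * a"
      proof (intro mult_mono ennreal_leI card_a)
        have "real n * b * eps \<le> R.rate * (real n * (eps - eps / 8) / 2 - 4 * B * lam * (real n * (2 * r)))"
          unfolding b_def by (rule R.rate_bound[OF n1 c]) (use eps in \<open>simp_all add: e0_def r_def\<close>)
        then show "exp (- (R.rate * (real n * (eps - eps / 8) / 2 - 4 * B * lam * (real n * (2 * r))))) \<le> exp (- (b * mx))"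
          by (simp add: mx ac_simps)
      qed auto
      finally show ?thesis .
    qed
    also have "\<dots> \<le> ennreal \<delta>"
    proof (cases "a' = 0")
      case False
      then have a'0: "0 < a'" using a' by simp
      have "(1 / b) * (ln a' + ln (1 / \<delta>)) \<le> mx" using False by (simp add: mx_def)
      then have "ln a' + ln (1 / \<delta>) \<le> b * mx" using b by (simp add: field_simps)
      then have "- (b * mx) \<le> ln \<delta> - ln a'" using delta by (simp add: ln_div)
      then have "exp (- (b * mx)) \<le> exp (ln \<delta> - ln a')" by simp
      also have "\<dots> = \<delta> / a'" using delta a'0 by (simp add: exp_diff)
      finally have "exp (- (b * mx)) * a' \<le> \<delta>" using a'0 by (simp add: field_simps)
      then show ?thesis unfolding a'(2) using a' by (subst ennreal_mult[symmetric]) (auto intro: ennreal_leI)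
    qed (simp add: a')
    finally have Bad_delta: "measure R.sample Bad \<le> \<delta>"
      using delta unfolding measure_def by (intro enn2real_leI) simp_all
    define E where "E = {\<omega> \<in> space M. zv \<omega> \<notin> Bad}"
    have zvBad: "zv -` Bad \<inter> space M \<in> sets M" using Bad by measurable
    have Ediff: "E = space M - (zv -` Bad \<inter> space M)" by (auto simp: E_def)
    have "measure M (zv -` Bad \<inter> space M) = measure R.sample Bad"
      using measure_distr[OF zv Bad] unfolding law by (rule sym)
    then have Eprob: "E \<in> sets M" "1 - \<delta> \<le> measure M E"
      unfolding Ediff prob_compl[OF zvBad] using zvBad Bad_delta by auto
    have "?lhs \<omega> \<le> ?rhs \<omega> + ?bound" if \<omega>: "\<omega> \<in> E" for \<omega>
    proof -
      have \<omega>M: "\<omega> \<in> space M" and good: "zv \<omega> \<notin> Bad" using \<omega> by (auto simp: E_def)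
      define g where "g = ghat (zv \<omega>)"
      define f where "f x = trunc B (g x)" for x
      have arg: "g \<in> G" "\<And>g'. g' \<in> G \<Longrightarrow> (\<Sum>k=1..n. \<bar>g (X k \<omega>) - trunc B (Y k \<omega>)\<bar>\<^sup>2) \<le> (\<Sum>k=1..n. \<bar>g' (X k \<omega>) - trunc B (Y k \<omega>)\<bar>\<^sup>2)"
        using ghat_argmin[OF \<omega>M] unfolding g_def zv_def is_arg_min_linorder by auto
      have gt: "gtilde \<in> G" using gtilde_argmin by (simp add: is_arg_min_def)
      note [measurable] = Gm[OF gt]
      have [measurable]: "f \<in> borel_measurable borel"
        unfolding f_def by (rule measurable_compose[OF Gm[OF arg(1)] trunc_measurable])
      have fb: "\<bar>f x\<bar> \<le> B" for x using trunc_bounds[of B "g x"] B by (simp add: f_def abs_le_iff)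
      \<comment> \<open>The empirical minimizer need not belong to the countable subfamily, but it is a limit of members\<close>
      have dev: "R.mean_bias f - lam * R.emp_excess f (zv \<omega>) \<le> mx"
      proof -
        obtain s where s: "\<And>i::nat. s i \<in> G0" "\<And>x. (\<lambda>i. s i x) \<longlonglongrightarrow> g x"
          using G0(3)[OF arg(1)] by blast
        define t where "t i x = trunc B (s i x)" for i x
        have tF: "t i \<in> F" for i using s(1)[of i] unfolding F_def trunc_family_def t_def by blast
        show ?thesis
        proof (rule R.deviation_limit[where f = t])
          show "t i \<in> borel_measurable borel" for i using tF F by auto
          show "\<bar>t i x\<bar> \<le> B" for i x using tF Fb by auto
          show "(\<lambda>i. t i x) \<longlonglongrightarrow> f x" for x
            unfolding t_def f_def trunc_def by (intro tendsto_intros s(2))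
          show "R.mean_bias (t i) - lam * R.emp_excess (t i) (zv \<omega>) \<le> mx" for i
            using good tF[of i] measurable_space[OF zv \<omega>M] by (auto simp: Bad_def mx not_less)
        qed measurable
      qed
      have emp: "R.emp_excess f (zv \<omega>) \<le> R.emp_excess gtilde (zv \<omega>)"
      proof -
        have "(\<Sum>k=1..n. (f (X k \<omega>) - trunc B (Y k \<omega>))\<^sup>2) \<le> (\<Sum>k=1..n. (g (X k \<omega>) - trunc B (Y k \<omega>))\<^sup>2)"
          unfolding f_def using B by (intro sum_mono trunc_loss_le) auto
        also have "\<dots> \<le> (\<Sum>k=1..n. (gtilde (X k \<omega>) - trunc B (Y k \<omega>))\<^sup>2)"
          using arg(2)[OF gt] by simp
        finally show ?thesis
          unfolding R.emp_excess_def R.excess_at_def by (simp add: sum_subtractf zv_def X_def Y_def)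
      qed
      have exc_le: "R.excess_at k (f (fst z)) z \<le> 4 * B\<^sup>2" for k z
      proof -
        have "\<bar>f (fst z) - trunc B (snd z)\<bar> \<le> \<bar>2 * B\<bar>"
          using fb[of "fst z"] trunc_bounds[of B "snd z"] B by (simp add: abs_le_iff)
        then have "(f (fst z) - trunc B (snd z))\<^sup>2 \<le> (2 * B)\<^sup>2" by (simp only: abs_le_square_iff)
        then have "(f (fst z) - trunc B (snd z))\<^sup>2 \<le> 4 * B\<^sup>2" by (simp add: power_mult_distrib)
        then show ?thesis
          unfolding R.excess_at_def using zero_le_power2[of "\<psi> k (fst z) - trunc B (snd z)"] by linarith
      qed
      define q where "q z = (gtilde (fst z) - trunc B (snd z))\<^sup>2" for z :: "'a \<times> real"
      define h where "h k z = R.excess_at k (gtilde (fst z)) z" for k z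
      have noise: "(\<psi> k (fst z) - trunc B (snd z))\<^sup>2 \<le> 4 * B\<^sup>2" for k and z :: "'a \<times> real"
      proof -
        have "\<bar>\<psi> k (fst z) - trunc B (snd z)\<bar> \<le> \<bar>2 * B\<bar>"
          using R.abs_phi[of k "fst z"] trunc_bounds[of B "snd z"] B by (simp add: abs_le_iff)
        then have "(\<psi> k (fst z) - trunc B (snd z))\<^sup>2 \<le> (2 * B)\<^sup>2" by (simp only: abs_le_square_iff)
        then show ?thesis by (simp add: power_mult_distrib)
      qed
      have hq: "q z - 4 * B\<^sup>2 \<le> h k z" for k z
        using noise[of k z] unfolding h_def R.excess_at_def q_def by linarith
      have q0: "0 \<le> q z" for z by (simp add: q_def)
      have qm: "q \<in> borel_measurable borel" and hm: "h k \<in> borel_measurable borel"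
        and fm: "(\<lambda>z. R.excess_at k (f (fst z)) z) \<in> borel_measurable borel" for k
        unfolding borel_prod[symmetric] q_def h_def by measurable
      have lhs_eq: "?lhs \<omega> = ext_expectation M (\<lambda>\<omega>'. \<Sum>k=1..n. R.excess_at k (f (fst (Z' k \<omega>'))) (Z' k \<omega>') - h k (Z' k \<omega>'))"
        by (intro arg_cong[where f = "ext_expectation M"] ext sum.cong) (auto simp: excess h_def f_def g_def)
      have rhs_eq: "?rhs \<omega> = (\<Sum>k=1..n. ereal (lam * h k (Z k \<omega>)) - ext_expectation M (\<lambda>\<omega>'. h k (Z k \<omega>')))"
        by (intro sum.cong) (auto simp: excess h_def)
      have Zlaw: "distr M borel (Z k) = mu k" if "k \<in> {1..n}" for k using that by (simp add: mu_def \<kappa>(2))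
      show ?thesis
      \<comment> \<open>If the loss of \<open>gtilde\<close> is not integrable, the left-hand side is \<open>-\<infinity>\<close>\<close>
      proof (cases "\<forall>k\<in>{1..n}. integrable (mu k) q")
        case True
        have ih: "integrable (mu k) (h k)" if "k \<in> {1..n}" for k
        proof -
          have "integrable (mu k) (\<lambda>z. (\<psi> k (fst z) - trunc B (snd z))\<^sup>2)"
          proof (rule R.M.integrable_const_bound[where B = "4 * B\<^sup>2"])
            show "AE z in mu k. norm ((\<psi> k (fst z) - trunc B (snd z))\<^sup>2) \<le> 4 * B\<^sup>2" using noise by simp
          qed measurable
          then have "integrable (mu k) (\<lambda>z. q z - (\<psi> k (fst z) - trunc B (snd z))\<^sup>2)"
            using True that by (intro Bochner_Integration.integrable_diff) blast+
          then show ?thesis unfolding h_def[abs_def] R.excess_at_def q_def .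
        qed
        have ihZ: "integrable M (\<lambda>\<omega>'. h k (Z k \<omega>'))" "(\<integral>\<omega>'. h k (Z k \<omega>') \<partial>M) = (\<integral>z. h k z \<partial>mu k)" if "k \<in> {1..n}" for k
          using ih[OF that] Zm[OF that] hm Zlaw[OF that] integrable_distr_eq[of "Z k" M borel "h k"] integral_distr[of "Z k" M borel "h k"]
          by auto
        have ihZ': "integrable M (\<lambda>\<omega>'. h k (Z' k \<omega>'))" "(\<integral>\<omega>'. h k (Z' k \<omega>') \<partial>M) = (\<integral>z. h k z \<partial>mu k)" if "k \<in> {1..n}" for k
          using ih[OF that] Z'm[OF that] hm law'[OF that] integrable_distr_eq[of "Z' k" M borel "h k"] integral_distr[of "Z' k" M borel "h k"]
          by auto
        have ifZ': "integrable M (\<lambda>\<omega>'. R.excess_at k (f (fst (Z' k \<omega>'))) (Z' k \<omega>'))"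
          "(\<integral>\<omega>'. R.excess_at k (f (fst (Z' k \<omega>'))) (Z' k \<omega>') \<partial>M) = (\<integral>z. R.sq_bias k (f (fst z)) (fst z) \<partial>mu k)" if "k \<in> {1..n}" for k
          using R.integral_excess_at[of f k] fb Z'm[OF that] fm law'[OF that]
            integrable_distr_eq[of "Z' k" M borel "\<lambda>z. R.excess_at k (f (fst z)) z"] integral_distr[of "Z' k" M borel "\<lambda>z. R.excess_at k (f (fst z)) z"]
          by auto
        have "?lhs \<omega> = ereal (\<integral>\<omega>'. (\<Sum>k=1..n. R.excess_at k (f (fst (Z' k \<omega>'))) (Z' k \<omega>') - h k (Z' k \<omega>')) \<partial>M)"
          unfolding lhs_eq using ihZ' ifZ'
          by (intro ext_expectation_integrable Bochner_Integration.integrable_sum Bochner_Integration.integrable_diff) auto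
        also have "(\<integral>\<omega>'. (\<Sum>k=1..n. R.excess_at k (f (fst (Z' k \<omega>'))) (Z' k \<omega>') - h k (Z' k \<omega>')) \<partial>M)
          = (\<Sum>k=1..n. (\<integral>z. R.sq_bias k (f (fst z)) (fst z) \<partial>mu k) - (\<integral>z. h k z \<partial>mu k))"
          using ihZ' ifZ' by (subst Bochner_Integration.integral_sum) (auto intro!: sum.cong)
        also have "\<dots> = R.mean_bias f - (\<Sum>k=1..n. \<integral>z. h k z \<partial>mu k)"
          unfolding R.mean_bias_def by (simp add: sum_subtractf)
        finally have l: "?lhs \<omega> = ereal (R.mean_bias f - (\<Sum>k=1..n. \<integral>z. h k z \<partial>mu k))" .
        have "?rhs \<omega> = (\<Sum>k=1..n. ereal (lam * h k (Z k \<omega>) - (\<integral>z. h k z \<partial>mu k)))"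
          unfolding rhs_eq using ihZ by (intro sum.cong) (auto simp: ext_expectation_integrable)
        also have "\<dots> = ereal (lam * (\<Sum>k=1..n. h k (Z k \<omega>)) - (\<Sum>k=1..n. \<integral>z. h k z \<partial>mu k))"
          by (simp add: sum_subtractf sum_distrib_left)
        also have "(\<Sum>k=1..n. h k (Z k \<omega>)) = R.emp_excess gtilde (zv \<omega>)"
          unfolding R.emp_excess_def by (simp add: h_def zv_def)
        finally have r: "?rhs \<omega> = ereal (lam * R.emp_excess gtilde (zv \<omega>) - (\<Sum>k=1..n. \<integral>z. h k z \<partial>mu k))" .
        have "lam * R.emp_excess f (zv \<omega>) \<le> lam * R.emp_excess gtilde (zv \<omega>)"
          using emp lam by (intro mult_left_mono) auto
        then show ?thesis unfolding l r bound using dev by simp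
      next
        case False
        then obtain k0 where k0: "k0 \<in> {1..n}" "\<not> integrable (mu k0) q" by auto
        have inf: "(\<integral>\<^sup>+ z. ennreal (q z) \<partial>mu k0) = \<infinity>"
        proof (rule ccontr)
          assume "\<not> ?thesis"
          moreover have "q \<in> borel_measurable (mu k0)" using qm by (simp add: mu_def)
          ultimately have "integrable (mu k0) q"
            using q0 by (intro integrableI_nonneg) (auto simp: less_top)
          then show False using k0(2) by simp
        qed
        have infZ': "(\<integral>\<^sup>+ \<omega>'. ennreal (q (Z' k0 \<omega>')) \<partial>M) = \<infinity>"
        proof -
          have "(\<integral>\<^sup>+ z. ennreal (q z) \<partial>distr M borel (Z' k0)) = (\<integral>\<^sup>+ \<omega>'. ennreal (q (Z' k0 \<omega>')) \<partial>M)"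
            using qm by (intro nn_integral_distr Z'm[OF k0(1)]) measurable
          then show ?thesis unfolding law'[OF k0(1)] inf by (rule sym)
        qed
        let ?d = "\<lambda>\<omega>'. \<Sum>k=1..n. R.excess_at k (f (fst (Z' k \<omega>'))) (Z' k \<omega>') - h k (Z' k \<omega>')"
        have dm: "?d \<in> borel_measurable M"
          using measurable_compose[OF Z'm fm] measurable_compose[OF Z'm hm]
          by (intro borel_measurable_sum borel_measurable_diff) auto
        have dq: "?d \<omega>' \<le> real n * (8 * B\<^sup>2) - q (Z' k0 \<omega>')" for \<omega>'
        proof -
          have "?d \<omega>' \<le> (\<Sum>k=1..n. 8 * B\<^sup>2 - (if k = k0 then q (Z' k0 \<omega>') else 0))"
          proof (rule sum_mono)
            fix k
            show "R.excess_at k (f (fst (Z' k \<omega>'))) (Z' k \<omega>') - h k (Z' k \<omega>') \<le> 8 * B\<^sup>2 - (if k = k0 then q (Z' k0 \<omega>') else 0)"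
              using exc_le[of k "Z' k \<omega>'"] hq[of "Z' k \<omega>'" k] q0[of "Z' k \<omega>'"] by auto
          qed
          also have "\<dots> = real n * (8 * B\<^sup>2) - q (Z' k0 \<omega>')" using k0(1) by (simp add: sum_subtractf)
          finally show ?thesis .
        qed
        have "?lhs \<omega> = - \<infinity>"
          unfolding lhs_eq
        proof (rule ext_expectation_MInf[OF dm])
          show "?d \<omega>' \<le> real n * (8 * B\<^sup>2)" for \<omega>' using dq[of \<omega>'] q0[of "Z' k0 \<omega>'"] by linarith
          show "(\<integral>\<^sup>+ \<omega>'. ennreal (- ?d \<omega>') \<partial>M) = \<infinity>"
          proof (rule nn_integral_shift_infinite[OF prob_space_axioms _ _ _ infZ'])
            show "q (Z' k0 \<omega>') - real n * (8 * B\<^sup>2) \<le> - ?d \<omega>'" for \<omega>' using dq[of \<omega>'] by linarith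
            show "(\<lambda>\<omega>'. - ?d \<omega>') \<in> borel_measurable M" using dm by (rule borel_measurable_uminus)
            show "(\<lambda>\<omega>'. q (Z' k0 \<omega>')) \<in> borel_measurable M"
              by (rule measurable_compose[OF Z'm[OF k0(1)] qm])
          qed
        qed
        then show ?thesis by simp
      qed
    qed
    then show ?thesis using Eprob by blast
  qed
  then show ?thesis unfolding zv_def a_def b_def e0_def .
qed

end
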